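(* For any $n\in\mathbb N$ and $\xi_1,\dots,\xi_n\in\mathcal F(X)$, the following identity of linear operators on the space $\mathcal P(M(X))$ of polynomials on $M(X)$ holds: $$\langle\omega,\xi_1\partial\rangle\cdots\langle\omega,\xi_n\partial\rangle=\sum_{k=1}^n\big\langle\omega^{\otimes k},\big(\mathbf S(n,k)(\xi_1\odot\dots\odot\xi_n)\big)\partial^{\otimes k}\big\rangle.$$
   Context: Let $X$ be a locally compact Polish space, $\mathbb F\in\{\mathbb R,\mathbb C\}$, $M(X)$ the set of $\mathbb F$-valued Radon measures on $X$. For $n\ge1$, $\mathcal F^{(n)}(X)$ is the space of bounded measurable symmetric compactly supported functions $X^n\to\mathbb F$, $\mathcal F(X)=\mathcal F^{(1)}(X)$, $\omega^{\otimes0}:=1$; $\langle\mu,f\rangle:=\int f\,d\mu$. $\xi_1\odot\dots\odot\xi_n$ is the symmetrization of $\xi_1\otimes\dots\otimes\xi_n$. $\mathcal P(M(X))$ is the space of polynomials $p(\omega)=\sum_{k=0}^N\langle\omega^{\otimes k},f^{(k)}\rangle$, $f^{(k)}\in\mathcal F^{(k)}(X)$. For $x\in X$, $(\partial_xp)(\omega):=\lim_{z\to0}(p(\omega+z\delta_x)-p(\omega))/z$. For $\xi\in\mathcal F(X)$ and $g\in\mathcal F^{(k)}(X)$, the operators on $\mathcal P(M(X))$ are $(\langle\omega,\xi\partial\rangle p)(\omega):=\int_X\xi(x)(\partial_xp)(\omega)\,\omega(dx)$ and $(\langle\omega^{\otimes k},g\partial^{\otimes k}\rangle p)(\omega):=\int_{X^k}g(x_1,\dots,x_k)(\partial_{x_1}\cdots\partial_{x_k}p)(\omega)\,\omega^{\otimes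 k}(dx_1\cdots dx_k)$. For $\omega\in M(X)$, $(\omega)_k(dx_1\cdots dx_k)=\omega(dx_1)(\omega(dx_2)-\delta_{x_1}(dx_2))\cdots(\omega(dx_k)-\delta_{x_1}(dx_k)-\dots-\delta_{x_{k-1}}(dx_k))$; for $1\le k\le n$, $\mathbf S(n,k):\mathcal F^{(n)}(X)\to\mathcal F^{(k)}(X)$ are the linear operators uniquely determined by $\langle\omega^{\otimes n},f\rangle=\sum_{k=1}^n\langle(\omega)_k,\mathbf S(n,k)f\rangle$ for all $\omega\in M(X)$, $f\in\mathcal F^{(n)}(X)$. *)

theory Defs
  imports "HOL-Analysis.Analysis" "HOL-Probability.Giry_Monad" "HOL-Combinatorics.Permutations"
begin

(* The space X is the type 'a::polish_space.  The scalar field is a type 'f of class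
   {real_normed_field, euclidean_space}: a finite-dimensional field extension of the reals with
   multiplicative norm.  By Frobenius (or Gelfand-Mazur) such a type is isometrically isomorphic
   to the reals or to the complex numbers, and both real and complex are instances, so
   quantifying over 'f is the same as letting the field range over these two. *)

definition relcompact_borel :: "'a::topological_space set set" where
  "relcompact_borel = {B \<in> sets borel. compact (closure B)}"

(* Locally finite Borel measures; on a locally compact Polish space regularity is automatic. *)
definition pos_radon :: "'a::topological_space measure \<Rightarrow> bool" where
  "pos_radon \<mu> \<longleftrightarrow> sets \<mu> = sets borel \<and> (\<forall>K. compact K \<longrightarrow> emeasure \<mu> K < \<infinity>)"

(* A list of pairs (c, \<mu>) stands for the formal linear combination of the measures \<mu> with
   coefficients c.  Since the \<mu> may have infinite total mass, its value only makes sense on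
   relatively compact Borel sets; elsewhere it is set to 0 to make equality extensional. *)
definition comb_value ::
    "('f::real_normed_field \<times> 'a::topological_space measure) list \<Rightarrow> 'a set \<Rightarrow> 'f" where
  "comb_value D B =
     (if B \<in> relcompact_borel then \<Sum>(c, \<mu>)\<leftarrow>D. c * of_real (measure \<mu> B) else 0)"

(* M(X): the set functions of the form \<mu>1 - \<mu>2 (real case) or \<mu>1 - \<mu>2 + i (\<mu>3 - \<mu>4)
   (complex case) with positive Radon measures \<mu>j, written uniformly as the linear span of the
   positive Radon measures. *)
definition radon_set_function :: "('a::topological_space set \<Rightarrow> 'f::real_normed_field) \<Rightarrow> bool" where
  "radon_set_function \<omega> \<longleftrightarrow> (\<exists>D. (\<forall>(c, \<mu>)\<in>set D. pos_radon \<mu>) \<and> \<omega> = comb_value D)"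

typedef (overloaded) ('a::topological_space, 'f::real_normed_field) radon =
  "{\<omega> :: 'a set \<Rightarrow> 'f. radon_set_function \<omega>}"
  morphisms value_on Abs_radon
proof -
  have "radon_set_function (comb_value [])" by (force simp: radon_set_function_def)
  then show ?thesis by blast
qed

setup_lifting type_definition_radon

lemma comb_value_Nil: "comb_value [] B = 0"
  by (simp add: comb_value_def)

lemma comb_value_append: "comb_value (D @ E) B = comb_value D B + comb_value E B"
  by (simp add: comb_value_def)

lemma comb_value_scale:
  "comb_value (map (\<lambda>(c, \<mu>). (z * c, \<mu>)) D) B = z * comb_value D B"
  by (induction D) (auto simp: comb_value_def algebra_simps)

lemma radon_set_functionI:
  assumes "\<And>B. \<omega> B = comb_value D B" "\<And>c \<mu>. (c, \<mu>) \<in> set D \<Longrightarrow> pos_radon \<mu>"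
  shows "radon_set_function \<omega>"
proof -
  have "\<omega> = comb_value D" using assms(1) by blast
  then show ?thesis using assms(2) by (auto simp: radon_set_function_def)
qed

lift_definition scale_radon :: "'f \<Rightarrow> ('a::topological_space, 'f::real_normed_field) radon \<Rightarrow> ('a, 'f) radon"
  is "\<lambda>z \<omega> B. z * \<omega> B"
proof -
  fix z :: 'f and \<omega> :: "'a set \<Rightarrow> 'f"
  assume "radon_set_function \<omega>"
  then obtain D where D: "\<omega> = comb_value D" "\<forall>(c, \<mu>)\<in>set D. pos_radon \<mu>" by (auto simp: radon_set_function_def)
  show "radon_set_function (\<lambda>B. z * \<omega> B)"
    using D by (intro radon_set_functionI[of _ "map (\<lambda>(c, \<mu>). (z * c, \<mu>)) D"])
      (auto simp: comb_value_scale)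
qed

instantiation radon :: (topological_space, real_normed_field) ab_group_add
begin

lift_definition zero_radon :: "('a, 'b) radon" is "\<lambda>_. 0"
  by (rule radon_set_functionI[of _ "[]"]) (auto simp: comb_value_def)

lift_definition plus_radon :: "('a, 'b) radon \<Rightarrow> ('a, 'b) radon \<Rightarrow> ('a, 'b) radon"
  is "\<lambda>\<omega> \<nu> B. \<omega> B + \<nu> B"
proof -
  fix \<omega> \<nu> :: "'a set \<Rightarrow> 'b"
  assume "radon_set_function \<omega>"
    "radon_set_function \<nu>"
  then obtain D E where "\<omega> = comb_value D" "\<forall>(c, \<mu>)\<in>set D. pos_radon \<mu>"
    "\<nu> = comb_value E" "\<forall>(c, \<mu>)\<in>set E. pos_radon \<mu>"
    by (auto simp: radon_set_function_def)
  then show "radon_set_function (\<lambda>B. \<omega> B + \<nu> B)"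
    by (intro radon_set_functionI[of _ "D @ E"]) (auto simp: comb_value_append)
qed

definition uminus_radon :: "('a, 'b) radon \<Rightarrow> ('a, 'b) radon" where
  "uminus_radon \<omega> = scale_radon (- 1) \<omega>"

definition minus_radon :: "('a, 'b) radon \<Rightarrow> ('a, 'b) radon \<Rightarrow> ('a, 'b) radon" where
  "minus_radon \<omega> \<nu> = \<omega> + (- \<nu>)"

instance
  by standard (unfold minus_radon_def uminus_radon_def, (transfer, simp add: fun_eq_iff)+)

end

lift_definition dirac :: "'a::t2_space \<Rightarrow> ('a, 'f::real_normed_field) radon"
  is "\<lambda>x B. if B \<in> relcompact_borel then indicator B x else 0"
proof -
  fix x :: 'a
  have "pos_radon (return borel x)"
    by (auto simp: pos_radon_def borel_compact indicator_def)
  then show "radon_set_function (\<lambda>B. if B \<in> relcompact_borel then indicator B x else (0::'f))"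
    by (intro radon_set_functionI[of _ "[(1, return borel x)]"])
      (auto simp: comb_value_def relcompact_borel_def measure_return indicator_def)
qed

definition decomposes ::
    "('f::real_normed_field \<times> 'a::topological_space measure) list \<Rightarrow> ('a, 'f) radon \<Rightarrow> bool" where
  "decomposes D \<omega> \<longleftrightarrow> (\<forall>(c, \<mu>)\<in>set D. pos_radon \<mu>) \<and> value_on \<omega> = comb_value D"

definition comb_integral ::
    "('f::{real_normed_field, euclidean_space} \<times> 'a::topological_space measure) list
      \<Rightarrow> ('a \<Rightarrow> 'f) \<Rightarrow> 'f" where
  "comb_integral D f = (\<Sum>(c, \<mu>)\<leftarrow>D. c * (\<integral>x. f x \<partial>\<mu>))"

(* The choice of the decomposition does not matter for bounded measurable compactly supported
   integrands, see radon_integral_eq below. *)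
definition radon_integral ::
    "('a::topological_space, 'f::{real_normed_field, euclidean_space}) radon
      \<Rightarrow> ('a \<Rightarrow> 'f) \<Rightarrow> 'f" where
  "radon_integral \<omega> f = comb_integral (SOME D. decomposes D \<omega>) f"

(* Iterated integral of f over X^k, where X^k is the set of x in {..<k} ->E UNIV and the
   coordinate x j is integrated against \<kappa> j x, which may depend on x 0, ..., x (j - 1):
   the integral over x 0 is the outermost one. *)
primrec iterated_integral ::
    "(nat \<Rightarrow> (nat \<Rightarrow> 'a::topological_space) \<Rightarrow> ('a, 'f::{real_normed_field, euclidean_space}) radon)
      \<Rightarrow> nat \<Rightarrow> ((nat \<Rightarrow> 'a) \<Rightarrow> 'f) \<Rightarrow> 'f" where
  "iterated_integral \<kappa> 0 f = f (\<lambda>_. undefined)"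
| "iterated_integral \<kappa> (Suc k) f =
     iterated_integral \<kappa> k (\<lambda>x. radon_integral (\<kappa> k x) (\<lambda>y. f (x(k := y))))"

(* Integral against the product measure \<omega>^k (characterised on boxes by tensor_integral_box). *)
definition tensor_integral ::
    "('a::topological_space, 'f::{real_normed_field, euclidean_space}) radon
      \<Rightarrow> nat \<Rightarrow> ((nat \<Rightarrow> 'a) \<Rightarrow> 'f) \<Rightarrow> 'f" where
  "tensor_integral \<omega> = iterated_integral (\<lambda>_ _. \<omega>)"

(* Integral against the falling factorial (\<omega>)_k. *)
definition falling_integral ::
    "('a::t2_space, 'f::{real_normed_field, euclidean_space}) radon
      \<Rightarrow> nat \<Rightarrow> ((nat \<Rightarrow> 'a) \<Rightarrow> 'f) \<Rightarrow> 'f" where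
  "falling_integral \<omega> = iterated_integral (\<lambda>j x. \<omega> - (\<Sum>i<j. dirac (x i)))"

lemma decomposes_exists: "\<exists>D. decomposes D \<omega>"
  using value_on[of \<omega>] by (auto simp: decomposes_def radon_set_function_def)

lemma borel_subset_compact_relcompact:
  assumes "compact (K :: 'a::t2_space set)" "B \<subseteq> K" "B \<in> sets borel"
  shows "B \<in> relcompact_borel"
proof -
  have "closure B \<subseteq> K" using assms by (simp add: closure_minimal compact_imp_closed)
  then have "compact (closure B)"
    using assms(1) closed_closure compact_Int_closed[of K "closure B"] by (simp add: Int_absorb1)
  then show ?thesis using assms(3) by (simp add: relcompact_borel_def)
qed

lemma pos_radon_integrable:
  fixes f :: "'a::t2_space \<Rightarrow> 'f::{banach, second_countable_topology}"
  assumes \<mu>: "pos_radon \<mu>" and f: "f \<in> borel_measurable borel" and c: "\<And>x. norm (f x) \<le> c"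
    and K: "compact K" "\<And>x. x \<notin> K \<Longrightarrow> f x = 0"
  shows "integrable \<mu> f"
proof -
  have s: "sets \<mu> = sets borel" and e: "emeasure \<mu> K < \<infinity>" using \<mu> K by (auto simp: pos_radon_def)
  have "f \<in> borel_measurable \<mu>" using f s by (simp cong: measurable_cong_sets)
  moreover have "K \<in> sets \<mu>" using K s by (simp add: borel_compact)
  ultimately show ?thesis
    using e K c by (intro integrableI_bounded_set[where A = K and B = c]) auto
qed

lemma comb_integral_simple:
  fixes g :: "'a::t2_space \<Rightarrow> 'f::{real_normed_field, euclidean_space}"
  assumes D: "\<forall>(c, \<mu>)\<in>set D. pos_radon \<mu>" and g: "simple_function borel g"
    and K: "compact K" "\<And>x. x \<notin> K \<Longrightarrow> g x = 0"
  shows "comb_integral D g = (\<Sum>y\<in>range g - {0}. comb_value D (g -` {y}) * y)"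
proof -
  have fin: "finite (range g)" using g by (simp add: simple_function_def)
  have B: "g -` {y} \<in> relcompact_borel" if "y \<noteq> 0" for y
  proof (rule borel_subset_compact_relcompact[OF K(1)])
    show "g -` {y} \<subseteq> K" using K(2) that by auto
    show "g -` {y} \<in> sets borel"
      using measurable_sets[OF borel_measurable_simple_function[OF g], of "{y}"] by simp
  qed
  have one: "(\<integral>x. g x \<partial>\<mu>) = (\<Sum>y\<in>range g - {0}. of_real (measure \<mu> (g -` {y})) * y)"
    if \<mu>: "pos_radon \<mu>" for \<mu>
  proof -
    have s: "sets \<mu> = sets borel" using \<mu> by (simp add: pos_radon_def)
    then have sp: "space \<mu> = UNIV" using sets_eq_imp_space_eq[of \<mu> borel] by simp
    have g\<mu>: "simple_function \<mu> g" using g s sp by (simp add: simple_function_def)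
    obtain c where "\<And>x. norm (g x) \<le> c"
      using finite_imp_bounded[OF fin] by (auto simp: bounded_iff)
    then have "integrable \<mu> g"
      using pos_radon_integrable[OF \<mu> borel_measurable_simple_function[OF g]] K by blast
    then have "(\<integral>\<^sup>+x. norm (g x) \<partial>\<mu>) < \<infinity>" by (simp add: integrable_iff_bounded)
    note bo = simple_bochner_integrableI_bounded[OF g\<mu> this]
    have "(\<integral>x. g x \<partial>\<mu>) = (\<Sum>y\<in>range g. measure \<mu> (g -` {y}) *\<^sub>R y)"
      by (simp add: simple_bochner_integrable_eq_integral[OF bo, symmetric]
          simple_bochner_integral_def sp vimage_def)
    also have "\<dots> = (\<Sum>y\<in>range g - {0}. measure \<mu> (g -` {y}) *\<^sub>R y)"
      using fin by (intro sum.mono_neutral_right) auto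
    finally show ?thesis by (simp add: scaleR_conv_of_real)
  qed
  show ?thesis using D
  proof (induction D)
    case Nil
    show ?case by (simp add: comb_integral_def comb_value_Nil)
  next
    case (Cons p D)
    obtain c \<mu> where p: "p = (c, \<mu>)" by force
    have "comb_integral (p # D) g = c * (\<integral>x. g x \<partial>\<mu>) + comb_integral D g"
      by (simp add: p comb_integral_def)
    also have "\<dots> = (\<Sum>y\<in>range g - {0}. c * of_real (measure \<mu> (g -` {y})) * y
        + comb_value D (g -` {y}) * y)"
      using Cons p one[of \<mu>] by (simp add: sum.distrib sum_distrib_left mult.assoc)
    also have "\<dots> = (\<Sum>y\<in>range g - {0}. comb_value (p # D) (g -` {y}) * y)"
      using B by (intro sum.cong) (auto simp: comb_value_def p algebra_simps)
    finally show ?case .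
  qed
qed

lemma comb_integral_tendsto:
  fixes f :: "'a::t2_space \<Rightarrow> 'f::{real_normed_field, euclidean_space}"
  assumes D: "\<forall>(c, \<mu>)\<in>set D. pos_radon \<mu>"
    and g: "\<And>i. g i \<in> borel_measurable borel" "\<And>x. (\<lambda>i. g i x) \<longlonglongrightarrow> f x"
      "\<And>i x. norm (g i x) \<le> c * indicator K x"
    and f: "f \<in> borel_measurable borel" and K: "compact K"
  shows "(\<lambda>i. comb_integral D (g i)) \<longlonglongrightarrow> comb_integral D f"
  using D
proof (induction D)
  case Nil
  then show ?case by (simp add: comb_integral_def)
next
  case (Cons p D)
  obtain a \<mu> where p: "p = (a, \<mu>)" by force
  have \<mu>: "pos_radon \<mu>" using Cons p by auto
  then have s: "sets \<mu> = sets borel" by (simp add: pos_radon_def)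
  have "(\<lambda>i. \<integral>x. g i x \<partial>\<mu>) \<longlonglongrightarrow> (\<integral>x. f x \<partial>\<mu>)"
  proof (rule integral_dominated_convergence[where w = "\<lambda>x. c * indicator K x"])
    show "integrable \<mu> (\<lambda>x. c * indicator K x)"
      using \<mu> K s by (intro integrable_mult_right integrable_real_indicator)
        (auto simp: pos_radon_def borel_compact)
  qed (use g f s in \<open>auto cong: measurable_cong_sets\<close>)
  then have "(\<lambda>i. a * (\<integral>x. g i x \<partial>\<mu>) + comb_integral D (g i))
      \<longlonglongrightarrow> a * (\<integral>x. f x \<partial>\<mu>) + comb_integral D f"
    using Cons by (intro tendsto_add tendsto_mult tendsto_const) auto
  then show ?case by (simp add: p comb_integral_def)
qed

lemma radon_integral_eq:
  fixes f :: "'a::t2_space \<Rightarrow> 'f::{real_normed_field, euclidean_space}"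
  assumes D: "decomposes D \<omega>" and f: "f \<in> borel_measurable borel" "\<And>x. norm (f x) \<le> c"
    and K: "compact K" "\<And>x. x \<notin> K \<Longrightarrow> f x = 0"
  shows "radon_integral \<omega> f = comb_integral D f"
proof -
  define E where "E = (SOME D. decomposes D \<omega>)"
  have E: "decomposes E \<omega>" unfolding E_def using decomposes_exists by (rule someI_ex)
  obtain g where g: "\<And>i. simple_function borel (g i)" "\<And>x. (\<lambda>i. g i x) \<longlonglongrightarrow> f x"
    "\<And>i x. norm (g i x) \<le> 2 * norm (f x)"
    using borel_measurable_implies_sequence_metric[OF f(1), of 0] by auto
  have z: "g i x = 0" if "x \<notin> K" for i x using g(3)[of i x] K(2)[OF that] by simp
  have b: "norm (g i x) \<le> (2 * c) * indicator K x" for i x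
    using g(3)[of i x] f(2)[of x] z[of x i] by (auto simp: indicator_def)
  have lim: "(\<lambda>i. comb_integral D' (g i)) \<longlonglongrightarrow> comb_integral D' f" if "decomposes D' \<omega>" for D'
    using that by (intro comb_integral_tendsto[OF _ borel_measurable_simple_function[OF g(1)] g(2) b f(1) K(1)])
      (auto simp: decomposes_def)
  have "comb_integral D (g i) = comb_integral E (g i)" for i
    using D E comb_integral_simple[OF _ g(1) K(1) z]
    by (simp add: decomposes_def)
  then have "comb_integral D f = comb_integral E f"
    using lim[OF D] lim[OF E] LIMSEQ_unique by simp
  then show ?thesis by (simp add: radon_integral_def E_def)
qed

lemma radon_integral_indicator:
  fixes \<omega> :: "('a::t2_space, 'f::{real_normed_field, euclidean_space}) radon"
  assumes "B \<in> relcompact_borel"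
  shows "radon_integral \<omega> (indicator B) = value_on \<omega> B"
proof -
  obtain D where D: "decomposes D \<omega>" using decomposes_exists by blast
  have B: "B \<in> sets borel" "compact (closure B)" using assms by (auto simp: relcompact_borel_def)
  have s: "simple_function borel (indicator B :: 'a \<Rightarrow> 'f)" using B by simp
  have z: "x \<notin> closure B \<Longrightarrow> indicator B x = (0::'f)" for x
    using closure_subset[of B] by (auto simp: indicator_def)
  have "radon_integral \<omega> (indicator B) = comb_integral D (indicator B)"
    by (rule radon_integral_eq[OF D borel_measurable_simple_function[OF s] _ B(2) z, of 1])
      (auto simp: indicator_def)
  also have "\<dots> = (\<Sum>y\<in>range (indicator B) - {0::'f}. comb_value D (indicator B -` {y}) * y)"
    using D comb_integral_simple[OF _ s B(2) z] by (simp add: decomposes_def)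
  also have "\<dots> = (\<Sum>y\<in>(if B = {} then {} else {1::'f}). comb_value D B)"
    by (intro sum.cong) (auto simp: indicator_def vimage_def image_iff split: if_splits)
  also have "\<dots> = comb_value D B" by (induction D) (auto simp: comb_value_def)
  finally show ?thesis using D by (simp add: decomposes_def)
qed

lemma radon_integral_cmult:
  "radon_integral \<omega> (\<lambda>x. a * f x) = a * radon_integral \<omega> f"
proof -
  have "comb_integral D (\<lambda>x. a * f x) = a * comb_integral D f" for D
    by (induction D) (auto simp: comb_integral_def algebra_simps)
  then show ?thesis by (simp add: radon_integral_def)
qed

lemma iterated_integral_cong:
  assumes "\<And>x. x \<in> {..<k} \<rightarrow>\<^sub>E UNIV \<Longrightarrow> f x = g x"
  shows "iterated_integral \<kappa> k f = iterated_integral \<kappa> k g"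
  using assms
proof (induction k arbitrary: f g)
  case 0
  then show ?case by auto
next
  case (Suc k)
  have "(\<lambda>y. f (x(k := y))) = (\<lambda>y. g (x(k := y)))" if "x \<in> {..<k} \<rightarrow>\<^sub>E UNIV" for x
    using that by (intro ext Suc.prems) (auto simp: PiE_def extensional_def)
  then show ?case unfolding iterated_integral.simps
    by (intro Suc.IH) (simp only:)
qed

lemma tensor_integral_cmult: "tensor_integral \<omega> k (\<lambda>x. a * f x) = a * tensor_integral \<omega> k f"
  unfolding tensor_integral_def
  by (induction k arbitrary: f) (auto simp: radon_integral_cmult)

lemma tensor_integral_box:
  fixes \<omega> :: "('a::t2_space, 'f::{real_normed_field, euclidean_space}) radon"
  assumes "\<And>i. i < k \<Longrightarrow> B i \<in> relcompact_borel"
  shows "tensor_integral \<omega> k (indicator (\<Pi>\<^sub>E i\<in>{..<k}. B i)) = (\<Prod>i<k. value_on \<omega> (B i))"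
  using assms
proof (induction k)
  case 0
  then show ?case by (simp add: tensor_integral_def)
next
  case (Suc k)
  have "tensor_integral \<omega> (Suc k) (indicator (\<Pi>\<^sub>E i\<in>{..<Suc k}. B i)) =
      iterated_integral (\<lambda>_ _. \<omega>) k
        (\<lambda>x. radon_integral \<omega> (\<lambda>y. indicator (\<Pi>\<^sub>E i\<in>{..<Suc k}. B i) (x(k := y))))"
    by (simp add: tensor_integral_def)
  also have "\<dots> = iterated_integral (\<lambda>_ _. \<omega>) k
        (\<lambda>x. radon_integral \<omega> (\<lambda>y. indicator (\<Pi>\<^sub>E i\<in>{..<k}. B i) x * indicator (B k) y))"
  proof (rule iterated_integral_cong, rule arg_cong[where f = "radon_integral \<omega>"], rule ext)
    fix x y assume "x \<in> {..<k} \<rightarrow>\<^sub>E (UNIV :: 'a set)"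
    then have "x(k := y) \<in> (\<Pi>\<^sub>E i\<in>{..<Suc k}. B i) \<longleftrightarrow> x \<in> (\<Pi>\<^sub>E i\<in>{..<k}. B i) \<and> y \<in> B k"
      by (auto simp: PiE_iff extensional_def less_Suc_eq)
    then show "indicator (\<Pi>\<^sub>E i\<in>{..<Suc k}. B i) (x(k := y)) =
        (indicator (\<Pi>\<^sub>E i\<in>{..<k}. B i) x * indicator (B k) y :: 'f)"
      by (simp add: indicator_def)
  qed
  also have "\<dots> = tensor_integral \<omega> k (\<lambda>x. value_on \<omega> (B k) * indicator (\<Pi>\<^sub>E i\<in>{..<k}. B i) x)"
    using Suc.prems[of k] radon_integral_indicator[of "B k" \<omega>]
    by (simp add: tensor_integral_def radon_integral_cmult) (simp add: mult.commute)
  also have "\<dots> = (\<Prod>i<Suc k. value_on \<omega> (B i))"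
    using Suc by (simp add: tensor_integral_cmult)
  finally show ?case .
qed

(* The space F(X). *)
definition test_functions :: "('a::topological_space \<Rightarrow> 'f::real_normed_vector) set" where
  "test_functions = {\<xi>. bounded (range \<xi>) \<and> \<xi> \<in> borel_measurable borel \<and>
     (\<exists>K. compact K \<and> (\<forall>x. x \<notin> K \<longrightarrow> \<xi> x = 0))}"

(* The space F^(n)(X).  As C lies in X^n = {..<n} ->E UNIV, the last condition also makes f
   vanish outside X^n, so equality of members is equality of functions on X^n.  For n = 0 the
   set X^0 is a singleton and the space consists of the constants. *)
definition sym_functions :: "nat \<Rightarrow> ((nat \<Rightarrow> 'a::topological_space) \<Rightarrow> 'f::real_normed_vector) set" where
  "sym_functions n = {f. bounded (range f) \<and>
     f \<in> borel_measurable (\<Pi>\<^sub>M i\<in>{..<n}. borel) \<and>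
     (\<forall>\<pi>. \<pi> permutes {..<n} \<longrightarrow> (\<forall>x\<in>{..<n} \<rightarrow>\<^sub>E UNIV. f (x \<circ> \<pi>) = f x)) \<and>
     (\<exists>C. compactin (product_topology (\<lambda>_. euclidean) {..<n}) C \<and> (\<forall>x. x \<notin> C \<longrightarrow> f x = 0))}"

(* \<xi> 0, ..., \<xi> (n - 1) are the n factors; the value is 0 outside X^n as in sym_functions. *)
definition sym_tensor :: "nat \<Rightarrow> (nat \<Rightarrow> 'a \<Rightarrow> 'f::field_char_0) \<Rightarrow> (nat \<Rightarrow> 'a) \<Rightarrow> 'f" where
  "sym_tensor n \<xi> x = (if x \<in> {..<n} \<rightarrow>\<^sub>E UNIV
     then (\<Sum>\<pi> | \<pi> permutes {..<n}. \<Prod>i<n. \<xi> (\<pi> i) (x i)) / fact n else 0)"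

definition polynomials ::
    "(('a::topological_space, 'f::{real_normed_field, euclidean_space}) radon \<Rightarrow> 'f) set" where
  "polynomials = {p. \<exists>N f. (\<forall>k\<le>N. f k \<in> sym_functions k) \<and>
     p = (\<lambda>\<omega>. \<Sum>k\<le>N. tensor_integral \<omega> k (f k))}"

definition partial_at ::
    "'a::t2_space \<Rightarrow> (('a, 'f::real_normed_field) radon \<Rightarrow> 'f) \<Rightarrow> ('a, 'f) radon \<Rightarrow> 'f" where
  "partial_at x p \<omega> = Lim (at 0) (\<lambda>z. (p (\<omega> + scale_radon z (dirac x)) - p \<omega>) / z)"

definition first_order_op ::
    "('a::t2_space \<Rightarrow> 'f::{real_normed_field, euclidean_space})
      \<Rightarrow> (('a, 'f) radon \<Rightarrow> 'f) \<Rightarrow> ('a, 'f) radon \<Rightarrow> 'f" where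
  "first_order_op \<xi> p \<omega> = radon_integral \<omega> (\<lambda>x. \<xi> x * partial_at x p \<omega>)"

definition higher_order_op ::
    "nat \<Rightarrow> ((nat \<Rightarrow> 'a::t2_space) \<Rightarrow> 'f::{real_normed_field, euclidean_space})
      \<Rightarrow> (('a, 'f) radon \<Rightarrow> 'f) \<Rightarrow> ('a, 'f) radon \<Rightarrow> 'f" where
  "higher_order_op k g p \<omega> =
     tensor_integral \<omega> k (\<lambda>x. g x * foldr (\<lambda>i. partial_at (x i)) [0..<k] p \<omega>)"

definition is_stirling_family ::
    "nat \<Rightarrow> (nat \<Rightarrow> ((nat \<Rightarrow> 'a::t2_space) \<Rightarrow> 'f::{real_normed_field, euclidean_space})
      \<Rightarrow> (nat \<Rightarrow> 'a) \<Rightarrow> 'f) \<Rightarrow> bool" where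
  "is_stirling_family n S \<longleftrightarrow>
     S \<in> (\<Pi>\<^sub>E k\<in>{1..n}. sym_functions n \<rightarrow>\<^sub>E sym_functions k) \<and>
     (\<forall>k\<in>{1..n}. \<forall>f\<in>sym_functions n. \<forall>g\<in>sym_functions n. \<forall>a b.
        S k (\<lambda>x. a * f x + b * g x) = (\<lambda>x. a * S k f x + b * S k g x)) \<and>
     (\<forall>f\<in>sym_functions n. \<forall>\<omega>.
        tensor_integral \<omega> n f = (\<Sum>k=1..n. falling_integral \<omega> k (S k f)))"

definition stirling_op ::
    "nat \<Rightarrow> nat \<Rightarrow> ((nat \<Rightarrow> 'a::t2_space) \<Rightarrow> 'f::{real_normed_field, euclidean_space})
      \<Rightarrow> (nat \<Rightarrow> 'a) \<Rightarrow> 'f" where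
  "stirling_op n = (THE S. is_stirling_family n S)"

end

theory Submission
  imports Defs
begin

text \<open>
  On a homogeneous polynomial \<open>p(\<omega>) = \<langle>\<omega>^m, f\<rangle>\<close> with symmetric \<open>f\<close>, the operator with coefficient \<open>g\<close> and
  \<open>k\<close> derivatives multiplies \<open>f\<close> by \<open>m (m - 1) \<dots> (m - k + 1) g(v_0, \<dots>, v_(k-1))\<close>, and up to symmetrization
  the first order operator with coefficient \<open>\<xi>\<close> multiplies \<open>f\<close> by the power sum \<open>\<xi>(v_0) + \<dots> + \<xi>(v_(m-1))\<close>.
  That power sum is the integral of \<open>\<xi>\<close> against the counting measure \<open>N = \<delta>_(v_0) + \<dots> + \<delta>_(v_(m-1))\<close>,
  so a product of power sums is the integral of the symmetrized tensor product against \<open>N^n\<close>.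
  The defining identity of the Stirling operators at \<open>\<omega> = N\<close> turns it into sums over injective tuples
  of indices, since \<open>(N)_k\<close> is the sum of the point masses at \<open>v \<circ> \<iota>\<close> with \<open>\<iota>\<close> injective. Permutation invariance
  of \<open>\<omega>^m\<close> makes all injections contribute equally, and there are \<open>m (m - 1) \<dots> (m - k + 1)\<close> of them.

  The same formula for \<open>(N)_k\<close> gives uniqueness of the Stirling operators. They exist because splitting
  \<open>\<omega>\<close> into the kernel of \<open>(\<omega>)_(k+1)\<close> and the \<open>k\<close> point masses expands \<open>\<omega>^n\<close> over set partitions, and
  \<open>(\<omega>)_k\<close> is permutation invariant by Fubini.
\<close>

section \<open>Integration against signed Radon measures\<close>

lemma test_functionsI:
  fixes f :: "'a::t2_space \<Rightarrow> 'f::real_normed_vector"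
  assumes "f \<in> borel_measurable borel" "\<And>x. norm (f x) \<le> c" "compact K" "\<And>x. x \<notin> K \<Longrightarrow> f x = 0"
  shows "f \<in> test_functions"
  using assms unfolding test_functions_def by (auto simp: bounded_iff)

lemma test_functionsE:
  fixes f :: "'a::t2_space \<Rightarrow> 'f::real_normed_vector"
  assumes "f \<in> test_functions"
  obtains c K where "f \<in> borel_measurable borel" "\<And>x. norm (f x) \<le> c" "compact K"
    "\<And>x. x \<notin> K \<Longrightarrow> f x = 0"
  using assms unfolding test_functions_def by (auto simp: bounded_iff)

lemma radon_integral_eq_test:
  fixes f :: "'a::t2_space \<Rightarrow> 'f::{real_normed_field, euclidean_space}"
  assumes "decomposes D \<omega>" "f \<in> test_functions"
  shows "radon_integral \<omega> f = comb_integral D f"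
  using assms(2) by (rule test_functionsE) (rule radon_integral_eq[OF assms(1)])

lemma comb_integral_append: "comb_integral (D @ E) f = comb_integral D f + comb_integral E f"
  by (simp add: comb_integral_def)

lemma comb_integral_scale:
  "comb_integral (map (\<lambda>(c, \<mu>). (z * c, \<mu>)) D) f = z * comb_integral D f"
  by (induction D) (auto simp: comb_integral_def algebra_simps)

text \<open>The integral is defined through an arbitrarily chosen decomposition, and the one chosen
  for a sum is unrelated to those of the summands. Concatenating decompositions of \<omega> and
  \<nu> decomposes the sum, and independence of the choice does the rest.\<close>

lemma radon_integral_measure_add:
  fixes f :: "'a::t2_space \<Rightarrow> 'f::{real_normed_field, euclidean_space}"
  assumes f: "f \<in> test_functions"
  shows "radon_integral (\<omega> + \<nu>) f = radon_integral \<omega> f + radon_integral \<nu> f"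
proof -
  obtain D E where D: "decomposes D \<omega>" and E: "decomposes E \<nu>" using decomposes_exists by metis
  have "decomposes (D @ E) (\<omega> + \<nu>)"
    using D E by (auto simp: decomposes_def plus_radon.rep_eq comb_value_append fun_eq_iff)
  then show ?thesis
    using radon_integral_eq_test[OF _ f] D E by (simp add: comb_integral_append)
qed

lemma radon_integral_measure_scale:
  fixes f :: "'a::t2_space \<Rightarrow> 'f::{real_normed_field, euclidean_space}"
  assumes f: "f \<in> test_functions"
  shows "radon_integral (scale_radon z \<omega>) f = z * radon_integral \<omega> f"
proof -
  obtain D where D: "decomposes D \<omega>" using decomposes_exists by metis
  have "decomposes (map (\<lambda>(c, \<mu>). (z * c, \<mu>)) D) (scale_radon z \<omega>)"
    using D by (auto simp: decomposes_def scale_radon.rep_eq comb_value_scale fun_eq_iff)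
  then show ?thesis
    using radon_integral_eq_test[OF _ f] D by (simp add: comb_integral_scale)
qed

lemma radon_integral_measure_diff:
  fixes f :: "'a::t2_space \<Rightarrow> 'f::{real_normed_field, euclidean_space}"
  assumes "f \<in> test_functions"
  shows "radon_integral (\<omega> - \<nu>) f = radon_integral \<omega> f - radon_integral \<nu> f"
  using assms
  by (simp add: minus_radon_def uminus_radon_def radon_integral_measure_add radon_integral_measure_scale)

lemma radon_integral_dirac:
  fixes f :: "'a::t2_space \<Rightarrow> 'f::{real_normed_field, euclidean_space}"
  assumes f: "f \<in> test_functions"
  shows "radon_integral (dirac x) f = f x"
proof -
  have "pos_radon (return borel x)"
    by (auto simp: pos_radon_def borel_compact indicator_def)
  then have "decomposes [(1, return borel x)] (dirac x :: ('a, 'f) radon)"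
    by (auto simp: decomposes_def dirac.rep_eq comb_value_def fun_eq_iff relcompact_borel_def
        measure_return indicator_def)
  then have "radon_integral (dirac x) f = comb_integral [(1, return borel x)] f"
    by (rule radon_integral_eq_test[OF _ f])
  also have "\<dots> = f x"
    using f by (auto elim!: test_functionsE simp: comb_integral_def integral_return)
  finally show ?thesis .
qed

lemma radon_integral_measure_zero:
  fixes f :: "'a::t2_space \<Rightarrow> 'f::{real_normed_field, euclidean_space}"
  assumes f: "f \<in> test_functions"
  shows "radon_integral 0 f = 0"
  using radon_integral_measure_add[OF f, of 0 0] by simp

lemma radon_integral_measure_sum:
  fixes f :: "'a::t2_space \<Rightarrow> 'f::{real_normed_field, euclidean_space}"
  assumes f: "f \<in> test_functions"
  shows "radon_integral (\<Sum>i\<in>I. \<nu> i) f = (\<Sum>i\<in>I. radon_integral (\<nu> i) f)"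
  by (induction I rule: infinite_finite_induct)
    (simp_all add: radon_integral_measure_zero radon_integral_measure_add f)

lemma scale_radon_0 [simp]: "scale_radon 0 \<omega> = 0"
  by transfer simp

lemma scale_radon_1 [simp]: "scale_radon 1 \<omega> = \<omega>"
  by transfer simp

section \<open>Localization to finite measures, and Fubini for signed Radon measures\<close>

text \<open>Radon measures may have infinite mass, but restricting every measure of a decomposition
  to \<open>K\<close> makes it finite without changing integrals of functions supported in
  \<open>K\<close>. One list \<open>D\<close> serves all such integrands, so statements about
  parametrized integrands reduce to a fixed finite combination of finite measures.\<close>

lemma radon_finite_decomposition:
  fixes \<omega> :: "('a::t2_space, 'f::{real_normed_field, euclidean_space}) radon"
  assumes K: "compact K"
  obtains D where "\<And>c \<mu>. (c, \<mu>) \<in> set D \<Longrightarrow> finite_measure \<mu> \<and> sets \<mu> = sets borel"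
    "\<And>f c. \<lbrakk>f \<in> borel_measurable borel; \<And>x. norm (f x) \<le> c; \<And>x. x \<notin> K \<Longrightarrow> f x = 0\<rbrakk>
      \<Longrightarrow> radon_integral \<omega> f = comb_integral D f"
proof -
  obtain E where E: "decomposes E \<omega>" using decomposes_exists by metis
  then have pos: "(c, \<mu>) \<in> set E \<Longrightarrow> pos_radon \<mu>" for c \<mu> by (auto simp: decomposes_def)
  \<comment> \<open>Restricting by a density keeps the Borel sigma-algebra of the whole space; the
    total mass becomes that of \<open>K\<close>.\<close>
  let ?r = "\<lambda>\<mu>. density \<mu> (\<lambda>x. ennreal (indicator K x))"
  define D where "D = map (\<lambda>(c, \<mu>). (c, ?r \<mu>)) E"
  show thesis
  proof
    fix c \<mu> assume "(c, \<mu>) \<in> set D"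
    then obtain \<nu> where \<nu>: "\<mu> = ?r \<nu>" "pos_radon \<nu>" using pos by (auto simp: D_def)
    then have s: "sets \<nu> = sets borel" by (simp add: pos_radon_def)
    then have Ks: "K \<in> sets \<nu>" using K by (simp add: borel_compact)
    then have "emeasure (?r \<nu>) (space \<nu>) = emeasure \<nu> K"
      using sets.sets_into_space[OF Ks]
      by (simp add: emeasure_density ennreal_indicator flip: indicator_inter_arith)
    then have "finite_measure \<mu>" using \<nu> K
      by (intro finite_measureI) (auto simp: pos_radon_def)
    then show "finite_measure \<mu> \<and> sets \<mu> = sets borel" using \<nu> s by simp
  next
    fix f :: "'a \<Rightarrow> 'f" and c
    assume f: "f \<in> borel_measurable borel" "\<And>x. norm (f x) \<le> c" "\<And>x. x \<notin> K \<Longrightarrow> f x = 0"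
    have "(\<integral>x. f x \<partial>?r \<mu>) = (\<integral>x. f x \<partial>\<mu>)" if "(c, \<mu>) \<in> set E" for c \<mu>
    proof -
      have s: "sets \<mu> = sets borel" using pos[OF that] by (simp add: pos_radon_def)
      have "(\<integral>x. f x \<partial>?r \<mu>) = (\<integral>x. indicator K x *\<^sub>R f x \<partial>\<mu>)"
        using f s K by (subst integral_density) (auto simp: borel_compact intro!: borel_measurable_indicator cong: measurable_cong_sets)
      also have "\<dots> = (\<integral>x. f x \<partial>\<mu>)"
        using f(3) by (intro Bochner_Integration.integral_cong) (auto simp: indicator_def)
      finally show ?thesis .
    qed
    then have "comb_integral D f = comb_integral E f"
      by (auto simp: comb_integral_def D_def o_def case_prod_beta intro!: arg_cong[where f = sum_list] map_cong)
    then show "radon_integral \<omega> f = comb_integral D f" using radon_integral_eq[OF E f(1,2) K f(3)] by simp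
  qed
qed

lemma finite_measure_integrable_bounded:
  fixes f :: "'a::topological_space \<Rightarrow> 'f::{banach, second_countable_topology}"
  assumes "finite_measure \<mu> \<and> sets \<mu> = sets borel" "f \<in> borel_measurable borel" "\<And>x. norm (f x) \<le> c"
  shows "integrable \<mu> f"
  using assms by (intro finite_measure.integrable_const_bound[where B = c]) (auto cong: measurable_cong_sets)

lemma comb_integral_add:
  fixes f g :: "'a::t2_space \<Rightarrow> 'f::{real_normed_field, euclidean_space}"
  assumes "\<And>c \<mu>. (c, \<mu>) \<in> set D \<Longrightarrow> integrable \<mu> f \<and> integrable \<mu> g"
  shows "comb_integral D (\<lambda>x. f x + g x) = comb_integral D f + comb_integral D g"
  using assms by (induction D) (fastforce simp: comb_integral_def distrib_left)+

lemma test_functions_add: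
  fixes f g :: "'a::t2_space \<Rightarrow> 'f::{real_normed_field, euclidean_space}"
  assumes f: "f \<in> test_functions" and g: "g \<in> test_functions"
  shows "(\<lambda>x. f x + g x) \<in> test_functions"
proof -
  obtain c K where 1: "f \<in> borel_measurable borel" "\<And>x. norm (f x) \<le> c" "compact K"
    "\<And>x. x \<notin> K \<Longrightarrow> f x = 0" by (rule test_functionsE[OF f]) blast
  obtain d L where 2: "g \<in> borel_measurable borel" "\<And>x. norm (g x) \<le> d" "compact L"
    "\<And>x. x \<notin> L \<Longrightarrow> g x = 0" by (rule test_functionsE[OF g]) blast
  show ?thesis
    using 1 2 by (intro test_functionsI[of _ "c + d" "K \<union> L"])
      (auto intro: norm_triangle_mono)
qed

lemma radon_integral_add:
  fixes f g :: "'a::t2_space \<Rightarrow> 'f::{real_normed_field, euclidean_space}"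
  assumes f: "f \<in> test_functions" and g: "g \<in> test_functions"
  shows "radon_integral \<omega> (\<lambda>x. f x + g x) = radon_integral \<omega> f + radon_integral \<omega> g"
proof -
  obtain D where D: "decomposes D \<omega>" using decomposes_exists by metis
  have int: "integrable \<mu> h" if "h \<in> test_functions" "(c, \<mu>) \<in> set D" for h :: "'a \<Rightarrow> 'f" and c \<mu>
    using that D by (auto elim!: test_functionsE intro!: pos_radon_integrable simp: decomposes_def)
  show ?thesis
    using f g int comb_integral_add[of D f g]
    by (simp add: radon_integral_eq_test[OF D] test_functions_add)
qed

text \<open>Fubini for a pair of finite measures extends bilinearly to the two lists. Additivity of
  the integral requires integrability at every stage, so the inductions carry it along.\<close>

lemma comb_integral_Fubini:
  fixes f :: "'a::{second_countable_topology, t2_space} \<Rightarrow> 'a \<Rightarrow> 'f::{real_normed_field, euclidean_space}"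
  assumes D: "\<And>c \<mu>. (c, \<mu>) \<in> set D \<Longrightarrow> finite_measure \<mu> \<and> sets \<mu> = sets borel"
    and E: "\<And>c \<mu>. (c, \<mu>) \<in> set E \<Longrightarrow> finite_measure \<mu> \<and> sets \<mu> = sets borel"
    and f: "case_prod f \<in> borel_measurable (borel \<Otimes>\<^sub>M borel)" "\<And>x y. norm (f x y) \<le> b"
  shows "comb_integral D (\<lambda>x. comb_integral E (\<lambda>y. f x y)) = comb_integral E (\<lambda>y. comb_integral D (\<lambda>x. f x y))"
proof -
  have one: "(\<integral>x. (\<integral>y. f x y \<partial>\<nu>) \<partial>\<mu>) = (\<integral>y. (\<integral>x. f x y \<partial>\<mu>) \<partial>\<nu>) \<and> integrable \<mu> (\<lambda>x. \<integral>y. f x y \<partial>\<nu>)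
     \<and> integrable \<nu> (\<lambda>y. \<integral>x. f x y \<partial>\<mu>)"
    if \<mu>: "finite_measure \<mu> \<and> sets \<mu> = sets borel" and \<nu>: "finite_measure \<nu> \<and> sets \<nu> = sets borel" for \<mu> \<nu>
  proof -
    interpret P: pair_sigma_finite \<mu> \<nu>
      using \<mu> \<nu> by (simp add: pair_sigma_finite_def finite_measure.axioms)
    interpret F: finite_measure "\<mu> \<Otimes>\<^sub>M \<nu>" using \<mu> \<nu> by (simp add: finite_measure_pair_measure)
    have "case_prod f \<in> borel_measurable (\<mu> \<Otimes>\<^sub>M \<nu>)"
      using f(1) \<mu> \<nu> by (simp cong: measurable_cong_sets sets_pair_measure_cong)
    then have i: "integrable (\<mu> \<Otimes>\<^sub>M \<nu>) (case_prod f)"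
      using f(2) by (intro F.integrable_const_bound[where B = b]) auto
    show ?thesis
      using P.Fubini_integral[OF i] P.integrable_fst[OF i] P.integrable_snd[OF i] by simp
  qed
  \<comment> \<open>The induction runs over lists whose entries lie in \<open>E\<close>, so the
    hypotheses on \<open>E\<close> remain available for every tail.\<close>
  have inner: "comb_integral E' (\<lambda>y. \<integral>x. f x y \<partial>\<mu>) = (\<integral>x. comb_integral E' (\<lambda>y. f x y) \<partial>\<mu>)
     \<and> integrable \<mu> (\<lambda>x. comb_integral E' (\<lambda>y. f x y))"
    if \<mu>: "finite_measure \<mu> \<and> sets \<mu> = sets borel" and E': "set E' \<subseteq> set E" for \<mu> E'
    using E'
  proof (induction E')
    case Nil
    then show ?case by (simp add: comb_integral_def)
  next
    case (Cons p E')
    obtain c \<nu> where p: "p = (c, \<nu>)" by force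
    have \<nu>: "finite_measure \<nu> \<and> sets \<nu> = sets borel" using Cons.prems E p by auto
    show ?case using one[OF \<mu> \<nu>] Cons by (simp add: p comb_integral_def)
  qed
  have "comb_integral D' (\<lambda>x. comb_integral E (\<lambda>y. f x y)) = comb_integral E (\<lambda>y. comb_integral D' (\<lambda>x. f x y))"
    if D': "set D' \<subseteq> set D" for D'
    using D'
  proof (induction D')
    case Nil
    then show ?case by (induction E) (auto simp: comb_integral_def)
  next
    case (Cons p D')
    obtain c \<mu> where p: "p = (c, \<mu>)" by force
    have \<mu>: "finite_measure \<mu> \<and> sets \<mu> = sets borel" using Cons.prems D p by auto
    have int: "integrable \<nu> (\<lambda>y. comb_integral D'' (\<lambda>x. f x y))"
      if "(d, \<nu>) \<in> set E" "set D'' \<subseteq> set D" for d \<nu> D''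
      using that(2)
    proof (induction D'')
      case Nil
      then show ?case by (simp add: comb_integral_def)
    next
      case (Cons q D'')
      then show ?case using one[of "snd q" \<nu>] D E[OF that(1)]
        by (cases q) (auto simp: comb_integral_def)
    qed
    have "comb_integral E (\<lambda>y. comb_integral (p # D') (\<lambda>x. f x y)) =
        comb_integral E (\<lambda>y. c * (\<integral>x. f x y \<partial>\<mu>) + comb_integral D' (\<lambda>x. f x y))"
      by (simp add: p comb_integral_def)
    also have "\<dots> = comb_integral E (\<lambda>y. c * (\<integral>x. f x y \<partial>\<mu>)) + comb_integral E (\<lambda>y. comb_integral D' (\<lambda>x. f x y))"
      using one[OF \<mu>] E int Cons.prems by (intro comb_integral_add) auto
    also have "comb_integral E (\<lambda>y. c * (\<integral>x. f x y \<partial>\<mu>)) = c * comb_integral E (\<lambda>y. \<integral>x. f x y \<partial>\<mu>)"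
      by (induction E) (auto simp: comb_integral_def algebra_simps)
    finally show ?case using inner[OF \<mu>, of E] Cons by (simp add: p comb_integral_def)
  qed
  then show ?thesis by simp
qed

lemma comb_integral_measurable:
  fixes f :: "'b \<Rightarrow> 'a::t2_space \<Rightarrow> 'f::{real_normed_field, euclidean_space}"
  assumes D: "\<And>c \<mu>. (c, \<mu>) \<in> set D \<Longrightarrow> finite_measure \<mu> \<and> sets \<mu> = sets borel"
    and f: "case_prod f \<in> borel_measurable (N \<Otimes>\<^sub>M borel)"
  shows "(\<lambda>x. comb_integral D (f x)) \<in> borel_measurable N"
  using D
proof (induction D)
  case Nil
  then show ?case by (simp add: comb_integral_def)
next
  case (Cons p D)
  obtain c \<mu> where p: "p = (c, \<mu>)" by force
  have \<mu>: "finite_measure \<mu>" "sets \<mu> = sets borel" using Cons.prems p by auto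
  interpret finite_measure \<mu> by (rule \<mu>)
  have "case_prod f \<in> borel_measurable (N \<Otimes>\<^sub>M \<mu>)"
    using f \<mu> by (simp cong: measurable_cong_sets sets_pair_measure_cong)
  then have "(\<lambda>x. \<integral>y. f x y \<partial>\<mu>) \<in> borel_measurable N" by (rule borel_measurable_lebesgue_integral)
  moreover have "(\<lambda>x. comb_integral D (f x)) \<in> borel_measurable N" using Cons by auto
  ultimately have "(\<lambda>x. c * (\<integral>y. f x y \<partial>\<mu>) + comb_integral D (f x)) \<in> borel_measurable N" by measurable
  then show ?case by (simp add: p comb_integral_def)
qed

text \<open>The sum of \<open>norm c\<close> times the total mass of \<mu> is such a constant. It is
  fixed before \<open>f\<close> and \<open>b\<close>, hence gives bounds uniform in a parameter of
  the integrand.\<close>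

lemma comb_integral_bound:
  fixes D :: "('f::{real_normed_field, euclidean_space} \<times> 'a::t2_space measure) list"
  assumes D: "\<And>c \<mu>. (c, \<mu>) \<in> set D \<Longrightarrow> finite_measure \<mu> \<and> sets \<mu> = sets borel"
  shows "\<exists>C. \<forall>f b. f \<in> borel_measurable borel \<longrightarrow> (\<forall>x. norm (f x) \<le> b) \<longrightarrow> norm (comb_integral D f) \<le> C * b"
  using D
proof (induction D)
    case Nil
    then show ?case by (auto simp: comb_integral_def intro!: exI[of _ 0])
  next
    case (Cons p D)
    obtain c \<mu> where p: "p = (c, \<mu>)" by force
    have \<mu>: "finite_measure \<mu> \<and> sets \<mu> = sets borel" using Cons.prems p by auto
    interpret finite_measure \<mu> using \<mu> by simp
    obtain C where C: "\<And>f b. f \<in> borel_measurable borel \<Longrightarrow> (\<And>x. norm (f x) \<le> b) \<Longrightarrow> norm (comb_integral D f) \<le> C * b"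
      using Cons.IH Cons.prems by (metis list.set_intros(2))
    have "norm (comb_integral (p # D) f) \<le> (norm c * measure \<mu> (space \<mu>) + C) * b"
      if f: "f \<in> borel_measurable borel" "\<And>x. norm (f x) \<le> b" for f b
    proof -
      have "integrable \<mu> f" using finite_measure_integrable_bounded[OF \<mu> f] .
      then have "norm (\<integral>x. f x \<partial>\<mu>) \<le> (\<integral>x. b \<partial>\<mu>)"
        using f(2) by (intro order.trans[OF integral_norm_bound] integral_mono) auto
      then have "norm (\<integral>x. f x \<partial>\<mu>) \<le> measure \<mu> (space \<mu>) * b" by simp
      then have "norm (c * (\<integral>x. f x \<partial>\<mu>)) \<le> norm c * measure \<mu> (space \<mu>) * b"
        by (simp add: norm_mult mult.assoc mult_left_mono)
      with C[OF f] show ?thesis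
        by (simp add: p comb_integral_def distrib_right)
           (rule norm_triangle_mono, auto simp: comb_integral_def)
    qed
    then show ?case by blast
qed

text \<open>This makes the inner integral of an iterated one a legitimate integrand again. The
  compact set is common to all parameters, so one finite decomposition computes all the
  integrals.\<close>

lemma radon_integral_measurable_bound:
  fixes f :: "'b \<Rightarrow> 'a::t2_space \<Rightarrow> 'f::{real_normed_field, euclidean_space}"
  assumes f: "case_prod f \<in> borel_measurable (N \<Otimes>\<^sub>M borel)"
    and b: "\<And>x y. x \<in> space N \<Longrightarrow> norm (f x y) \<le> b"
    and K: "compact K" "\<And>x y. x \<in> space N \<Longrightarrow> y \<notin> K \<Longrightarrow> f x y = 0"
  shows "(\<lambda>x. radon_integral \<nu> (f x)) \<in> borel_measurable N \<and>
    (\<exists>C. \<forall>x\<in>space N. norm (radon_integral \<nu> (f x)) \<le> C)"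
proof -
  obtain D where D: "\<And>c \<mu>. (c, \<mu>) \<in> set D \<Longrightarrow> finite_measure \<mu> \<and> sets \<mu> = sets borel"
    "\<And>f c. \<lbrakk>f \<in> borel_measurable borel; \<And>x. norm (f x) \<le> c; \<And>x. x \<notin> K \<Longrightarrow> f x = 0\<rbrakk>
      \<Longrightarrow> radon_integral \<nu> f = comb_integral D f" by (rule radon_finite_decomposition[OF K(1)]) blast
  obtain C where C: "\<forall>f b. f \<in> borel_measurable borel \<longrightarrow> (\<forall>x. norm (f x) \<le> b) \<longrightarrow> norm (comb_integral D f) \<le> C * b"
    using comb_integral_bound[of D] D(1) by blast
  have m: "f x \<in> borel_measurable borel" if "x \<in> space N" for x
    using measurable_Pair2[OF f that] by simp
  have eq: "radon_integral \<nu> (f x) = comb_integral D (f x)" if "x \<in> space N" for x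
    using D(2)[OF m[OF that] b[OF that] K(2)[OF that]] .
  have "(\<lambda>x. radon_integral \<nu> (f x)) \<in> borel_measurable N"
    using comb_integral_measurable[OF D(1) f] eq by (simp cong: measurable_cong)
  moreover have "norm (radon_integral \<nu> (f x)) \<le> C * b" if "x \<in> space N" for x
    using C m[OF that] b[OF that] eq[OF that] by simp
  ultimately show ?thesis by blast
qed

lemma radon_integral_const_0 [simp]: "radon_integral \<nu> (\<lambda>_. 0) = 0"
  using radon_integral_cmult[of \<nu> 0 "\<lambda>_. 0"] by simp

lemma radon_integral_Fubini:
  fixes f :: "'a::{second_countable_topology, t2_space} \<Rightarrow> 'a \<Rightarrow> 'f::{real_normed_field, euclidean_space}"
  assumes f: "case_prod f \<in> borel_measurable (borel \<Otimes>\<^sub>M borel)" "\<And>x y. norm (f x y) \<le> b"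
    and K: "compact K" "\<And>x y. x \<notin> K \<or> y \<notin> K \<Longrightarrow> f x y = 0"
  shows "radon_integral \<nu> (\<lambda>x. radon_integral \<nu> (\<lambda>y. f x y)) =
    radon_integral \<nu> (\<lambda>y. radon_integral \<nu> (\<lambda>x. f x y))"
proof -
  obtain D where D: "\<And>c \<mu>. (c, \<mu>) \<in> set D \<Longrightarrow> finite_measure \<mu> \<and> sets \<mu> = sets borel"
    "\<And>f c. \<lbrakk>f \<in> borel_measurable borel; \<And>x. norm (f x) \<le> c; \<And>x. x \<notin> K \<Longrightarrow> f x = 0\<rbrakk>
      \<Longrightarrow> radon_integral \<nu> f = comb_integral D f" by (rule radon_finite_decomposition[OF K(1)]) blast
  \<comment> \<open>Stated for an arbitrary \<open>g\<close>, since it is applied both to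
    \<open>f\<close> and to \<open>f\<close> with its arguments exchanged.\<close>
  have *: "radon_integral \<nu> (\<lambda>x. radon_integral \<nu> (\<lambda>y. g x y)) = comb_integral D (\<lambda>x. comb_integral D (\<lambda>y. g x y))"
    if g: "case_prod g \<in> borel_measurable (borel \<Otimes>\<^sub>M borel)" "\<And>x y. norm (g x y) \<le> b"
      "\<And>x y. x \<notin> K \<or> y \<notin> K \<Longrightarrow> g x y = 0" for g
  proof -
    have "g x \<in> borel_measurable borel" for x using measurable_Pair2[OF g(1), of x] by simp
    then have eq: "radon_integral \<nu> (\<lambda>y. g x y) = comb_integral D (\<lambda>y. g x y)" for x
      using g by (intro D(2)) auto
    obtain C where "(\<lambda>x. radon_integral \<nu> (g x)) \<in> borel_measurable borel"
       "\<And>x. norm (radon_integral \<nu> (g x)) \<le> C"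
      using radon_integral_measurable_bound[OF g(1), of b K \<nu>] g K(1) by auto
    moreover have "g x = (\<lambda>_. 0)" if "x \<notin> K" for x using g(3) that by auto
    ultimately show ?thesis by (subst D(2)) (auto simp: eq)
  qed
  have swap: "(\<lambda>(y, x). f x y) \<in> borel_measurable (borel \<Otimes>\<^sub>M borel)"
    using measurable_pair_swap_iff[THEN iffD1, OF f(1)] by simp
  have "radon_integral \<nu> (\<lambda>x. radon_integral \<nu> (\<lambda>y. f x y)) = comb_integral D (\<lambda>x. comb_integral D (\<lambda>y. f x y))"
    using f K(2) by (intro *) auto
  also have "\<dots> = comb_integral D (\<lambda>y. comb_integral D (\<lambda>x. f x y))"
    by (rule comb_integral_Fubini[OF D(1) D(1) f])
  also have "\<dots> = radon_integral \<nu> (\<lambda>y. radon_integral \<nu> (\<lambda>x. f x y))"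
    using f(2) K(2) swap by (intro *[symmetric]) auto
  finally show ?thesis .
qed

section \<open>Admissible functions and iterated integrals\<close>

abbreviation tuples :: "nat \<Rightarrow> (nat \<Rightarrow> 'a) set" where
  "tuples k \<equiv> {..<k} \<rightarrow>\<^sub>E UNIV"

text \<open>A version of \<open>sym_functions\<close> without symmetry that is stable under fixing
  or integrating out the last coordinate. One compact set confines all coordinates, and values off
  \<open>tuples k\<close> are left free because substitution into a coordinate does not preserve
  vanishing there.\<close>

definition admissible :: "nat \<Rightarrow> ((nat \<Rightarrow> 'a::topological_space) \<Rightarrow> 'f::real_normed_vector) \<Rightarrow> bool" where
  "admissible k f \<longleftrightarrow> f \<in> borel_measurable (\<Pi>\<^sub>M i\<in>{..<k}. borel) \<and> (\<exists>c. \<forall>x\<in>tuples k. norm (f x) \<le> c) \<and>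
     (\<exists>K. compact K \<and> (\<forall>x\<in>tuples k. (\<exists>i<k. x i \<notin> K) \<longrightarrow> f x = 0))"

lemma admissibleE:
  assumes "admissible k f"
  obtains c K where "f \<in> borel_measurable (\<Pi>\<^sub>M i\<in>{..<k}. borel)"
    "\<And>x. x \<in> tuples k \<Longrightarrow> norm (f x) \<le> c" "compact K"
    "\<And>x i. \<lbrakk>x \<in> tuples k; i < k; x i \<notin> K\<rbrakk> \<Longrightarrow> f x = 0"
  using assms unfolding admissible_def by metis

lemma admissibleI:
  assumes "f \<in> borel_measurable (\<Pi>\<^sub>M i\<in>{..<k}. borel)"
    "\<And>x. x \<in> tuples k \<Longrightarrow> norm (f x) \<le> c" "compact K"
    "\<And>x i. \<lbrakk>x \<in> tuples k; i < k; x i \<notin> K\<rbrakk> \<Longrightarrow> f x = 0"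
  shows "admissible k f"
  using assms unfolding admissible_def by blast

lemma space_tuples: "space (\<Pi>\<^sub>M i\<in>{..<k::nat}. (borel :: 'a::topological_space measure)) = tuples k"
  by (simp add: space_PiM)

lemma admissible_cong:
  assumes "\<And>x. x \<in> tuples k \<Longrightarrow> f x = g x"
  shows "admissible k f \<longleftrightarrow> admissible k g"
  using assms measurable_cong[of "\<Pi>\<^sub>M i\<in>{..<k}. borel" f g borel]
  by (simp add: admissible_def space_tuples cong: ball_cong)

lemma fun_upd_tuples: "x \<in> tuples k \<Longrightarrow> x(k := y) \<in> tuples (Suc k)"
  by (auto simp: PiE_iff extensional_def)

lemma admissible_times:
  fixes f g :: "(nat \<Rightarrow> 'a::topological_space) \<Rightarrow> 'f::{real_normed_field, euclidean_space}"
  assumes g: "g \<in> borel_measurable (\<Pi>\<^sub>M i\<in>{..<k}. borel)" "\<And>x. x \<in> tuples k \<Longrightarrow> norm (g x) \<le> b"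
    and f: "admissible k f"
  shows "admissible k (\<lambda>x. g x * f x)"
proof -
  obtain c K where 1: "f \<in> borel_measurable (\<Pi>\<^sub>M i\<in>{..<k}. borel)"
    "\<And>x. x \<in> tuples k \<Longrightarrow> norm (f x) \<le> c" "compact K"
    "\<And>x i. \<lbrakk>x \<in> tuples k; i < k; x i \<notin> K\<rbrakk> \<Longrightarrow> f x = 0" by (rule admissibleE[OF f]) blast
  have "norm (g x * f x) \<le> b * c" if "x \<in> tuples k" for x
    unfolding norm_mult using g(2)[OF that] 1(2)[OF that] order.trans[OF norm_ge_zero g(2)[OF that]]
    by (intro mult_mono) auto
  with 1 g(1) show ?thesis by (intro admissibleI[where c = "b * c" and K = K]) auto
qed

lemma admissible_cmult:
  fixes f :: "(nat \<Rightarrow> 'a::topological_space) \<Rightarrow> 'f::{real_normed_field, euclidean_space}"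
  shows "admissible k f \<Longrightarrow> admissible k (\<lambda>x. a * f x)"
  by (rule admissible_times[of _ _ "norm a"]) auto

lemma admissible_0:
  "admissible k (\<lambda>_. 0)"
  by (rule admissibleI[of _ _ 0 "{}"]) auto

lemma admissible_add:
  fixes f g :: "(nat \<Rightarrow> 'a::t2_space) \<Rightarrow> 'f::{real_normed_field, euclidean_space}"
  assumes f: "admissible k f" and g: "admissible k g"
  shows "admissible k (\<lambda>x. f x + g x)"
proof -
  obtain c K where 1: "f \<in> borel_measurable (\<Pi>\<^sub>M i\<in>{..<k}. borel)"
    "\<And>x. x \<in> tuples k \<Longrightarrow> norm (f x) \<le> c" "compact K"
    "\<And>x i. \<lbrakk>x \<in> tuples k; i < k; x i \<notin> K\<rbrakk> \<Longrightarrow> f x = 0" by (rule admissibleE[OF f]) blast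
  obtain d L where 2: "g \<in> borel_measurable (\<Pi>\<^sub>M i\<in>{..<k}. borel)"
    "\<And>x. x \<in> tuples k \<Longrightarrow> norm (g x) \<le> d" "compact L"
    "\<And>x i. \<lbrakk>x \<in> tuples k; i < k; x i \<notin> L\<rbrakk> \<Longrightarrow> g x = 0" by (rule admissibleE[OF g]) blast
  show ?thesis
    using 1 2 by (intro admissibleI[of _ _ "c + d" "K \<union> L"]) (auto intro: norm_triangle_mono)
qed

lemma admissible_sum:
  fixes f :: "'i \<Rightarrow> (nat \<Rightarrow> 'a::t2_space) \<Rightarrow> 'f::{real_normed_field, euclidean_space}"
  assumes "\<And>i. i \<in> I \<Longrightarrow> admissible k (f i)"
  shows "admissible k (\<lambda>x. \<Sum>i\<in>I. f i x)"
  using assms by (induction I rule: infinite_finite_induct) (auto intro: admissible_add admissible_0)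

lemma admissible_sum_list:
  fixes f :: "'i \<Rightarrow> (nat \<Rightarrow> 'a::t2_space) \<Rightarrow> 'f::{real_normed_field, euclidean_space}"
  assumes "\<And>i. i \<in> set I \<Longrightarrow> admissible k (f i)"
  shows "admissible k (\<lambda>x. \<Sum>i\<leftarrow>I. f i x)"
  using assms by (induction I) (auto intro: admissible_add admissible_0)

lemma admissible_measurable_update:
  assumes "admissible (Suc k) f"
  shows "(\<lambda>(x, y). f (x(k := y))) \<in> borel_measurable ((\<Pi>\<^sub>M i\<in>{..<k}. borel) \<Otimes>\<^sub>M borel)"
proof -
  have "f \<in> borel_measurable (\<Pi>\<^sub>M i\<in>insert k {..<k}. borel)"
    using assms by (simp add: admissible_def lessThan_Suc)
  then have "f \<circ> (\<lambda>(x, y). x(k := y)) \<in> borel_measurable ((\<Pi>\<^sub>M i\<in>{..<k}. borel) \<Otimes>\<^sub>M borel)"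
    by (rule measurable_comp[OF measurable_add_dim])
  then show ?thesis by (simp add: o_def case_prod_beta)
qed

lemma admissible_section:
  fixes f :: "(nat \<Rightarrow> 'a::t2_space) \<Rightarrow> 'f::{real_normed_field, euclidean_space}"
  assumes f: "admissible (Suc k) f" and x: "x \<in> tuples k"
  shows "(\<lambda>y. f (x(k := y))) \<in> test_functions"
proof -
  obtain c K where 1: "f \<in> borel_measurable (\<Pi>\<^sub>M i\<in>{..<Suc k}. borel)"
    "\<And>x. x \<in> tuples (Suc k) \<Longrightarrow> norm (f x) \<le> c" "compact K"
    "\<And>x i. \<lbrakk>x \<in> tuples (Suc k); i < Suc k; x i \<notin> K\<rbrakk> \<Longrightarrow> f x = 0" by (rule admissibleE[OF f]) blast
  have "(\<lambda>y. f (x(k := y))) \<in> borel_measurable borel"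
    using measurable_Pair2[OF admissible_measurable_update[OF f], of x] x by (simp add: space_tuples)
  then show ?thesis
    using 1(2)[OF fun_upd_tuples[OF x]] 1(3) 1(4)[OF fun_upd_tuples[OF x], of k]
    by (intro test_functionsI[of _ c K]) auto
qed

lemma admissible_integral:
  fixes f :: "(nat \<Rightarrow> 'a::t2_space) \<Rightarrow> 'f::{real_normed_field, euclidean_space}"
  assumes f: "admissible (Suc k) f"
  shows "admissible k (\<lambda>x. radon_integral \<nu> (\<lambda>y. f (x(k := y))))"
proof -
  obtain c K where 1: "f \<in> borel_measurable (\<Pi>\<^sub>M i\<in>{..<Suc k}. borel)"
    "\<And>x. x \<in> tuples (Suc k) \<Longrightarrow> norm (f x) \<le> c" "compact K"
    "\<And>x i. \<lbrakk>x \<in> tuples (Suc k); i < Suc k; x i \<notin> K\<rbrakk> \<Longrightarrow> f x = 0" by (rule admissibleE[OF f]) blast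
  have K0: "f (x(k := y)) = 0" if "x \<in> tuples k" "y \<notin> K" for x y
    using 1(4)[OF fun_upd_tuples[OF that(1)], of k] that by auto
  obtain C where C: "(\<lambda>x. radon_integral \<nu> (\<lambda>y. f (x(k := y)))) \<in> borel_measurable (\<Pi>\<^sub>M i\<in>{..<k}. borel)"
    "\<forall>x\<in>tuples k. norm (radon_integral \<nu> (\<lambda>y. f (x(k := y)))) \<le> C"
    using radon_integral_measurable_bound[OF admissible_measurable_update[OF f], of c K \<nu>]
      1(2)[OF fun_upd_tuples] 1(3) K0 by (auto simp: space_tuples)
  have "radon_integral \<nu> (\<lambda>y. f (x(k := y))) = 0" if "x \<in> tuples k" "i < k" "x i \<notin> K" for x i
  proof -
    have "(\<lambda>y. f (x(k := y))) = (\<lambda>_. 0)"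
      using 1(4)[OF fun_upd_tuples[OF that(1)], of i] that by auto
    then show ?thesis by simp
  qed
  with C 1(3) show ?thesis by (intro admissibleI[of _ _ C K]) auto
qed

text \<open>Fixing the last coordinate is integrating it against a point mass.\<close>

lemma admissible_fix:
  fixes f :: "(nat \<Rightarrow> 'a::t2_space) \<Rightarrow> 'f::{real_normed_field, euclidean_space}"
  assumes f: "admissible (Suc k) f"
  shows "admissible k (\<lambda>u. f (u(k := x)))"
  using admissible_integral[OF f, of "dirac x"]
  by (rule admissible_cong[THEN iffD1, rotated]) (rule radon_integral_dirac[OF admissible_section[OF f]])

text \<open>Surjectivity of \<sigma> guarantees that each coordinate of \<open>x\<close> is read by
  \<open>f\<close>, so that compact support passes to the pulled back function. Non-injective
  \<sigma> are the restrictions to diagonals.\<close>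

lemma admissible_pull:
  fixes f :: "(nat \<Rightarrow> 'a::topological_space) \<Rightarrow> 'f::real_normed_vector"
  assumes f: "admissible n f" and \<sigma>: "\<sigma> ` {..<n} = {..<k}"
  shows "admissible k (\<lambda>x. f (\<lambda>i\<in>{..<n}. x (\<sigma> i)))"
proof -
  obtain c K where 1: "f \<in> borel_measurable (\<Pi>\<^sub>M i\<in>{..<n}. borel)"
    "\<And>x. x \<in> tuples n \<Longrightarrow> norm (f x) \<le> c" "compact K"
    "\<And>x i. \<lbrakk>x \<in> tuples n; i < n; x i \<notin> K\<rbrakk> \<Longrightarrow> f x = 0" by (rule admissibleE[OF f]) blast
  have "(\<lambda>x. \<lambda>i\<in>{..<n}. x (\<sigma> i)) \<in> measurable (\<Pi>\<^sub>M i\<in>{..<k}. borel) (\<Pi>\<^sub>M i\<in>{..<n}. (borel :: 'a measure))"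
    using \<sigma> by (intro measurable_restrict measurable_component_singleton) auto
  from measurable_comp[OF this 1(1)]
  have "(\<lambda>x. f (\<lambda>i\<in>{..<n}. x (\<sigma> i))) \<in> borel_measurable (\<Pi>\<^sub>M i\<in>{..<k}. borel)" by (simp add: o_def)
  moreover have "f (\<lambda>i\<in>{..<n}. x (\<sigma> i)) = 0" if "j < k" "x j \<notin> K" for x j
  proof -
    have "j \<in> \<sigma> ` {..<n}" using \<sigma> that by simp
    then obtain i where "i < n" "\<sigma> i = j" by auto
    then show ?thesis using 1(4)[of "\<lambda>i\<in>{..<n}. x (\<sigma> i)" i] that by auto
  qed
  ultimately show ?thesis using 1(2,3) by (intro admissibleI[of _ _ c K]) auto
qed

lemma fun_upd_comp_permutes:
  fixes k :: nat
  assumes "\<pi> permutes {..<k}"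
  shows "(x \<circ> \<pi>)(k := y) = x(k := y) \<circ> \<pi>"
proof -
  have "\<pi> k = k" using permutes_not_in[OF assms, of k] by simp
  then have "\<pi> i = k \<longleftrightarrow> i = k" for i using inj_eq[OF permutes_inj[OF assms], of i k] by simp
  then show ?thesis by (simp add: fun_eq_iff)
qed

lemma comp_permutes_tuples:
  assumes "\<pi> permutes {..<k}" "x \<in> tuples k"
  shows "x \<circ> \<pi> \<in> tuples k"
  using assms by (auto simp: PiE_iff extensional_def permutes_not_in)

lemma tuples_comp_permutes_eq:
  assumes "\<pi> permutes {..<k}" "x \<in> tuples k"
  shows "(\<lambda>i\<in>{..<k}. x (\<pi> i)) = x \<circ> \<pi>"
  using assms by (auto simp: PiE_iff extensional_def permutes_not_in fun_eq_iff)

lemma admissible_permute: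
  fixes f :: "(nat \<Rightarrow> 'a::topological_space) \<Rightarrow> 'f::real_normed_vector"
  assumes f: "admissible k f" and \<pi>: "\<pi> permutes {..<k}"
  shows "admissible k (\<lambda>x. f (x \<circ> \<pi>))"
  using admissible_pull[OF f permutes_image[OF \<pi>]]
  by (rule admissible_cong[THEN iffD1, rotated]) (simp add: tuples_comp_permutes_eq[OF \<pi>])

section \<open>A common family for product measures and falling factorials\<close>

text \<open>The parameter \<open>c\<close> treats product measures (\<open>c = 0\<close>) and falling factorials (\<open>c = 1\<close>) simultaneously.\<close>

definition interp_kernel ::
    "'f \<Rightarrow> ('a::t2_space, 'f::real_normed_field) radon \<Rightarrow> nat \<Rightarrow> (nat \<Rightarrow> 'a) \<Rightarrow> ('a, 'f) radon" where
  "interp_kernel c \<omega> j x = \<omega> - scale_radon c (\<Sum>i<j. dirac (x i))"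

definition interp_integral ::
    "'f \<Rightarrow> ('a::t2_space, 'f::{real_normed_field, euclidean_space}) radon \<Rightarrow> nat \<Rightarrow> ((nat \<Rightarrow> 'a) \<Rightarrow> 'f) \<Rightarrow> 'f" where
  "interp_integral c \<omega> = iterated_integral (interp_kernel c \<omega>)"

lemma tensor_integral_interp: "tensor_integral \<omega> = interp_integral 0 \<omega>"
  by (simp add: tensor_integral_def interp_integral_def interp_kernel_def[abs_def])

lemma falling_integral_interp: "falling_integral \<omega> = interp_integral 1 \<omega>"
  by (simp add: falling_integral_def interp_integral_def interp_kernel_def[abs_def])

lemma interp_integral_0: "interp_integral c \<omega> 0 f = f (\<lambda>_. undefined)"
  by (simp add: interp_integral_def)

lemma interp_integral_Suc: "interp_integral c \<omega> (Suc k) f =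
    interp_integral c \<omega> k (\<lambda>x. radon_integral (interp_kernel c \<omega> k x) (\<lambda>y. f (x(k := y))))"
  by (simp add: interp_integral_def)

lemma interp_integral_cong:
  "(\<And>x. x \<in> tuples k \<Longrightarrow> f x = g x) \<Longrightarrow> interp_integral c \<omega> k f = interp_integral c \<omega> k g"
  unfolding interp_integral_def by (rule iterated_integral_cong)

lemma interp_integral_cmult:
  "interp_integral c \<omega> k (\<lambda>x. a * f x) = a * interp_integral c \<omega> k f"
  by (induction k arbitrary: f) (simp_all add: interp_integral_0 interp_integral_Suc radon_integral_cmult)

lemma interp_kernel_integral:
  fixes f :: "'a::t2_space \<Rightarrow> 'f::{real_normed_field, euclidean_space}"
  assumes "f \<in> test_functions"
  shows "radon_integral (interp_kernel c \<omega> k x) f = radon_integral \<omega> f - c * (\<Sum>i<k. f (x i))"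
  using assms by (simp add: interp_kernel_def radon_integral_measure_diff radon_integral_measure_scale
      radon_integral_measure_sum radon_integral_dirac)

text \<open>Against the kernel, the point masses substitute an earlier coordinate \<open>x i\<close>
  for the last one. Each such substitution is a pullback to a diagonal.\<close>

lemma admissible_interp_kernel:
  fixes f :: "(nat \<Rightarrow> 'a::t2_space) \<Rightarrow> 'f::{real_normed_field, euclidean_space}"
  assumes f: "admissible (Suc k) f"
  shows "admissible k (\<lambda>x. radon_integral (interp_kernel c \<omega> k x) (\<lambda>y. f (x(k := y))))"
proof -
  have "admissible k (\<lambda>x. f (\<lambda>j\<in>{..<Suc k}. x ((id(k := i)) j)))" if "i < k" for i
    using that by (intro admissible_pull[OF f]) (auto simp: image_iff less_Suc_eq)
  then have "admissible k (\<lambda>x. f (x(k := x i)))" if "i < k" for i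
    by (rule admissible_cong[THEN iffD1, rotated])
      (use that in \<open>auto intro!: arg_cong[where f = f] simp: fun_eq_iff PiE_iff extensional_def\<close>)
  then have "admissible k (\<lambda>x. radon_integral \<omega> (\<lambda>y. f (x(k := y))) + (- c) * (\<Sum>i<k. f (x(k := x i))))"
    by (intro admissible_add admissible_integral admissible_cmult admissible_sum f) auto
  then show ?thesis
    by (rule admissible_cong[THEN iffD1, rotated]) (simp add: interp_kernel_integral admissible_section[OF f])
qed

lemma interp_integral_add:
  fixes f g :: "(nat \<Rightarrow> 'a::t2_space) \<Rightarrow> 'f::{real_normed_field, euclidean_space}"
  assumes "admissible k f" "admissible k g"
  shows "interp_integral c \<omega> k (\<lambda>x. f x + g x) = interp_integral c \<omega> k f + interp_integral c \<omega> k g"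
  using assms
proof (induction k arbitrary: f g)
  case 0
  show ?case by (simp add: interp_integral_0)
next
  case (Suc k)
  have "interp_integral c \<omega> (Suc k) (\<lambda>x. f x + g x) = interp_integral c \<omega> k (\<lambda>x.
      radon_integral (interp_kernel c \<omega> k x) (\<lambda>y. f (x(k := y))) +
      radon_integral (interp_kernel c \<omega> k x) (\<lambda>y. g (x(k := y))))"
    unfolding interp_integral_Suc
    by (intro interp_integral_cong radon_integral_add admissible_section Suc.prems)
  then show ?case
    by (simp add: Suc.IH admissible_interp_kernel Suc.prems interp_integral_Suc)
qed

lemma interp_integral_const_0: "interp_integral c \<omega> k (\<lambda>_. 0) = 0"
  using interp_integral_cmult[of c \<omega> k 0 "\<lambda>_. 0"] by simp

lemma interp_integral_sum:
  fixes f :: "'i \<Rightarrow> (nat \<Rightarrow> 'a::t2_space) \<Rightarrow> 'f::{real_normed_field, euclidean_space}"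
  assumes "\<And>i. i \<in> I \<Longrightarrow> admissible k (f i)"
  shows "interp_integral c \<omega> k (\<lambda>x. \<Sum>i\<in>I. f i x) = (\<Sum>i\<in>I. interp_integral c \<omega> k (f i))"
  using assms
  by (induction I rule: infinite_finite_induct)
    (simp_all add: interp_integral_add admissible_sum interp_integral_const_0)

lemma interp_integral_sum_list:
  fixes f :: "'i \<Rightarrow> (nat \<Rightarrow> 'a::t2_space) \<Rightarrow> 'f::{real_normed_field, euclidean_space}"
  assumes "\<And>i. i \<in> set I \<Longrightarrow> admissible k (f i)"
  shows "interp_integral c \<omega> k (\<lambda>x. \<Sum>i\<leftarrow>I. f i x) = (\<Sum>i\<leftarrow>I. interp_integral c \<omega> k (f i))"
  using assms
  by (induction I) (simp_all add: interp_integral_add admissible_sum_list interp_integral_const_0)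

section \<open>Permutation invariance\<close>

text \<open>The kernel at level \<open>k\<close> depends on the earlier points only through the sum
  of their point masses, which a permutation does not change. The permutation can therefore be
  absorbed by the outer \<open>k\<close> integrations.\<close>

lemma interp_integral_permute_initial:
  fixes f :: "(nat \<Rightarrow> 'a::t2_space) \<Rightarrow> 'f::{real_normed_field, euclidean_space}"
  assumes IH: "\<And>g. admissible k g \<Longrightarrow> interp_integral c \<omega> k (\<lambda>x. g (x \<circ> \<pi>)) = interp_integral c \<omega> k g"
    and \<pi>: "\<pi> permutes {..<k}" and f: "admissible (Suc k) f"
  shows "interp_integral c \<omega> (Suc k) (\<lambda>x. f (x \<circ> \<pi>)) = interp_integral c \<omega> (Suc k) f"
proof -
  define F where "F x = radon_integral (interp_kernel c \<omega> k x) (\<lambda>y. f (x(k := y)))" for x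
  have ker: "interp_kernel c \<omega> k (x \<circ> \<pi>) = interp_kernel c \<omega> k x" for x
    using sum.permute[OF \<pi>, of "\<lambda>i. dirac (x i) :: ('a, 'f) radon"] by (simp add: interp_kernel_def o_def)
  have "interp_integral c \<omega> (Suc k) (\<lambda>x. f (x \<circ> \<pi>)) = interp_integral c \<omega> k (\<lambda>x. F (x \<circ> \<pi>))"
    by (simp add: interp_integral_Suc F_def ker flip: fun_upd_comp_permutes[OF \<pi>])
  also have "\<dots> = interp_integral c \<omega> k F"
    by (rule IH) (unfold F_def, rule admissible_interp_kernel[OF f])
  finally show ?thesis by (simp add: interp_integral_Suc F_def[abs_def])
qed

text \<open>With \<open>\<nu>\<close> the kernel at level \<open>j\<close>, the last two integrations are \<open>\<nu> \<otimes> \<nu>\<close> minus \<open>c\<close> times the image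
  of \<open>\<nu>\<close> on the diagonal, and both parts are symmetric.\<close>

lemma interp_integral_swap_last:
  fixes f :: "(nat \<Rightarrow> 'a::{second_countable_topology, t2_space}) \<Rightarrow> 'f::{real_normed_field, euclidean_space}"
  assumes f: "admissible (Suc (Suc j)) f"
  shows "interp_integral c \<omega> (Suc (Suc j)) (\<lambda>x. f (x \<circ> Transposition.transpose j (Suc j))) = interp_integral c \<omega> (Suc (Suc j)) f"
proof -
  let ?k = "Suc j" and ?\<tau> = "Transposition.transpose j (Suc j)"
  have \<tau>: "?\<tau> permutes {..<Suc (Suc j)}" by (rule permutes_swap_id) auto
  have two: "interp_integral c \<omega> (Suc ?k) g = interp_integral c \<omega> j (\<lambda>x.
      radon_integral (interp_kernel c \<omega> j x) (\<lambda>y. radon_integral (interp_kernel c \<omega> j x) (\<lambda>z. g (x(j := y, ?k := z))))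
      + (- c) * radon_integral (interp_kernel c \<omega> j x) (\<lambda>y. g (x(j := y, ?k := y))))"
    if g: "admissible (Suc ?k) g" for g
    unfolding interp_integral_Suc
  proof (rule interp_integral_cong)
    fix x :: "nat \<Rightarrow> 'a" assume x: "x \<in> tuples j"
    let ?\<nu> = "interp_kernel c \<omega> j x"
    have a: "radon_integral (interp_kernel c \<omega> ?k (x(j := y))) (\<lambda>z. g (x(j := y, ?k := z))) =
        radon_integral ?\<nu> (\<lambda>z. g (x(j := y, ?k := z))) + (- c) * g (x(j := y, ?k := y))" for y
      using admissible_section[OF g fun_upd_tuples[OF x], of y]
      by (simp add: interp_kernel_integral algebra_simps)
    have b: "(\<lambda>y. radon_integral ?\<nu> (\<lambda>z. g (x(j := y, ?k := z)))) \<in> test_functions"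
      by (rule admissible_section[OF admissible_integral[OF g] x])
    have "admissible ?k (\<lambda>x. g (\<lambda>i\<in>{..<Suc ?k}. x ((id(?k := j)) i)))"
      by (intro admissible_pull[OF g]) (auto simp: image_iff less_Suc_eq)
    then have diag: "admissible ?k (\<lambda>x. g (x(?k := x j)))"
      by (rule admissible_cong[THEN iffD1, rotated])
        (auto intro!: arg_cong[where f = g] simp: fun_eq_iff PiE_iff extensional_def)
    have d: "(\<lambda>y. (- c) * g (x(j := y, ?k := y))) \<in> test_functions"
      using admissible_section[OF admissible_cmult[OF diag] x, of "- c"] by simp
    show "radon_integral ?\<nu> (\<lambda>y. radon_integral (interp_kernel c \<omega> ?k (x(j := y))) (\<lambda>z. g (x(j := y, ?k := z)))) =
      radon_integral ?\<nu> (\<lambda>y. radon_integral ?\<nu> (\<lambda>z. g (x(j := y, ?k := z))))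
      + (- c) * radon_integral ?\<nu> (\<lambda>y. g (x(j := y, ?k := y)))"
      unfolding a radon_integral_add[OF b d] radon_integral_cmult ..
  qed
  obtain b K where 1: "f \<in> borel_measurable (\<Pi>\<^sub>M i\<in>{..<Suc ?k}. borel)"
    "\<And>x. x \<in> tuples (Suc ?k) \<Longrightarrow> norm (f x) \<le> b" "compact K"
    "\<And>x i. \<lbrakk>x \<in> tuples (Suc ?k); i < Suc ?k; x i \<notin> K\<rbrakk> \<Longrightarrow> f x = 0" by (rule admissibleE[OF f]) blast
  have swap: "x(j := y, ?k := z) \<circ> ?\<tau> = x(j := z, ?k := y)" for x :: "nat \<Rightarrow> 'a" and y z
    by (auto simp: fun_eq_iff Transposition.transpose_def)
  have Fub: "radon_integral \<nu> (\<lambda>y. radon_integral \<nu> (\<lambda>z. f (x(j := z, ?k := y)))) =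
      radon_integral \<nu> (\<lambda>z. radon_integral \<nu> (\<lambda>y. f (x(j := z, ?k := y))))" if x: "x \<in> tuples j" for x \<nu>
  proof (rule radon_integral_Fubini[OF _ _ 1(3), of _ b, symmetric])
    note t = fun_upd_tuples[OF fun_upd_tuples[OF x]]
    have "(\<lambda>(z, y). x(j := z, ?k := y)) \<in> measurable (borel \<Otimes>\<^sub>M borel) (\<Pi>\<^sub>M i\<in>{..<Suc ?k}. borel)"
    proof (rule measurable_PiM_single')
      show "(\<lambda>p i. (\<lambda>(z, y). x(j := z, ?k := y)) p i) \<in> space (borel \<Otimes>\<^sub>M borel) \<rightarrow> (\<Pi>\<^sub>E i\<in>{..<Suc ?k}. space borel)"
        using t by auto
      fix i show "(\<lambda>p. (\<lambda>(z, y). x(j := z, ?k := y)) p i) \<in> borel_measurable (borel \<Otimes>\<^sub>M borel)"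
        by (cases "i = ?k"; cases "i = j") (auto simp: case_prod_beta)
    qed
    from measurable_comp[OF this 1(1)]
    show "(\<lambda>(z, y). f (x(j := z, ?k := y))) \<in> borel_measurable (borel \<Otimes>\<^sub>M borel)"
      by (simp add: o_def case_prod_beta)
    show "norm (f (x(j := z, ?k := y))) \<le> b" for z y by (rule 1(2)[OF t])
    show "f (x(j := z, ?k := y)) = 0" if "z \<notin> K \<or> y \<notin> K" for z y
      using 1(4)[OF t, of j z y] 1(4)[OF t, of ?k z y] that by auto
  qed
  have "interp_integral c \<omega> (Suc ?k) (\<lambda>x. f (x \<circ> ?\<tau>)) = interp_integral c \<omega> (Suc ?k) f"
    unfolding two[OF admissible_permute[OF f \<tau>]] two[OF f] swap
    by (rule interp_integral_cong) (simp add: Fub)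
  then show ?thesis .
qed

text \<open>Permutations of the first \<open>k\<close> coordinates, handled by induction, together
  with the exchange of the last two generate the whole symmetric group.\<close>

lemma interp_integral_permute:
  fixes f :: "(nat \<Rightarrow> 'a::{second_countable_topology, t2_space}) \<Rightarrow> 'f::{real_normed_field, euclidean_space}"
  assumes "\<pi> permutes {..<k}" "admissible k f"
  shows "interp_integral c \<omega> k (\<lambda>x. f (x \<circ> \<pi>)) = interp_integral c \<omega> k f"
  using assms
proof (induction k arbitrary: \<pi> f)
  case 0
  then show ?case by simp
next
  case (Suc k)
  \<comment> \<open>Invariance is required for all admissible integrands at once; this is what makes
    the set of such permutations closed under composition.\<close>
  define inv where "inv \<rho> \<longleftrightarrow> \<rho> permutes {..<Suc k} \<and> (\<forall>f::(nat \<Rightarrow> 'a) \<Rightarrow> 'f. admissible (Suc k) f \<longrightarrow>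
    interp_integral c \<omega> (Suc k) (\<lambda>x. f (x \<circ> \<rho>)) = interp_integral c \<omega> (Suc k) f)" for \<rho>
  have initial: "inv \<rho>" if "\<rho> permutes {..<k}" for \<rho>
    unfolding inv_def using interp_integral_permute_initial[OF Suc.IH[OF that] that] permutes_subset[OF that, of "{..<Suc k}"]
    by auto
  have comp: "inv (\<rho> \<circ> \<sigma>)" if "inv \<rho>" "inv \<sigma>" for \<rho> \<sigma>
    unfolding inv_def
  proof (intro conjI allI impI)
    show "\<rho> \<circ> \<sigma> permutes {..<Suc k}" using that by (auto simp: inv_def intro: permutes_compose)
    fix f :: "(nat \<Rightarrow> 'a) \<Rightarrow> 'f" assume f: "admissible (Suc k) f"
    then have "admissible (Suc k) (\<lambda>x. f (x \<circ> \<sigma>))" using that by (simp add: inv_def admissible_permute)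
    then have "interp_integral c \<omega> (Suc k) (\<lambda>x. f (x \<circ> \<rho> \<circ> \<sigma>)) = interp_integral c \<omega> (Suc k) (\<lambda>x. f (x \<circ> \<sigma>))"
      using that(1) unfolding inv_def by blast
    then show "interp_integral c \<omega> (Suc k) (\<lambda>x. f (x \<circ> (\<rho> \<circ> \<sigma>))) = interp_integral c \<omega> (Suc k) f"
      using that(2) f by (simp add: inv_def comp_assoc)
  qed
  have last: "inv (Transposition.transpose a k)" if ak: "a < k" for a
  proof -
    obtain j where j: "k = Suc j" using ak by (cases k) auto
    have jk: "inv (Transposition.transpose j k)"
      unfolding inv_def j by (auto intro: interp_integral_swap_last permutes_swap_id)
    show ?thesis
    proof (cases "a = j")
      case False
      then have "inv (Transposition.transpose a j)" using that j by (intro initial permutes_swap_id) auto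
      \<comment> \<open>Conjugating the exchange of \<open>j\<close> and \<open>k\<close> by a
        transposition of initial coordinates yields the exchange of \<open>a\<close> and
        \<open>k\<close>.\<close>
      then have "inv (Transposition.transpose a j \<circ> (Transposition.transpose j k \<circ> Transposition.transpose a j))" using jk comp by blast
      also have "Transposition.transpose a j \<circ> (Transposition.transpose j k \<circ> Transposition.transpose a j) = Transposition.transpose a k"
        using False that j by (auto simp: fun_eq_iff Transposition.transpose_def)
      finally show ?thesis .
    qed (use jk in simp)
  qed
  have tr: "inv (Transposition.transpose a b)" if ab: "a < Suc k" "b < Suc k" "a \<noteq> b" for a b
  proof -
    consider "a < k" "b < k" | "a < k" "b = k" | "a = k" "b < k" using ab by linarith
    then show ?thesis
    proof cases
      case 1 then show ?thesis by (intro initial permutes_swap_id) auto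
    next
      case 2 then show ?thesis using last by simp
    next
      case 3 then show ?thesis using last[of b] by (simp add: Transposition.transpose_commute)
    qed
  qed
  have "inv \<pi>"
  proof (rule permutes_induct[OF Suc.prems(1)])
    show "inv id" by (rule initial) (rule permutes_id)
    show "inv (Transposition.transpose a b \<circ> p)" if "a \<in> {..<Suc k}" "b \<in> {..<Suc k}" "a \<noteq> b" "inv p" for a b p
      using that by (intro comp tr) auto
  qed simp
  then show ?case using Suc.prems(2) unfolding inv_def by blast
qed

section \<open>The Stirling operators\<close>

text \<open>A partition of \<open>{..<n}\<close> into \<open>k\<close> blocks is encoded by the map sending each element to the number of its
  block, blocks being numbered in the order of their smallest elements; values beyond \<open>n\<close> are irrelevant.\<close>

primrec restricted_growths :: "nat \<Rightarrow> nat \<Rightarrow> (nat \<Rightarrow> nat) list" where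
  "restricted_growths 0 k = (if k = 0 then [\<lambda>_. 0] else [])"
| "restricted_growths (Suc n) k =
     concat (map (\<lambda>\<sigma>. map (\<lambda>i. \<sigma>(n := i)) [0..<k]) (restricted_growths n k)) @
     (case k of 0 \<Rightarrow> [] | Suc j \<Rightarrow> map (\<lambda>\<sigma>. \<sigma>(n := j)) (restricted_growths n j))"

text \<open>No block is empty. This is the surjectivity that \<open>admissible_pull\<close>
  requires.\<close>

lemma restricted_growths_image:
  "\<sigma> \<in> set (restricted_growths n k) \<Longrightarrow> \<sigma> ` {..<n} = {..<k}"
proof -
  have "\<forall>\<sigma>\<in>set (restricted_growths n k). \<sigma> ` {..<n} = {..<k}"
  proof (induction n arbitrary: k)
    case (Suc n)
    have upd: "(\<tau>(n := i)) ` {..<Suc n} = insert i (\<tau> ` {..<n})" for \<tau> :: "nat \<Rightarrow> nat" and i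
      by (auto simp: lessThan_Suc)
    have set_eq: "set (restricted_growths (Suc n) k) =
        (\<Union>\<sigma>\<in>set (restricted_growths n k). (\<lambda>i. \<sigma>(n := i)) ` {..<k}) \<union>
        (case k of 0 \<Rightarrow> {} | Suc j \<Rightarrow> (\<lambda>\<sigma>. \<sigma>(n := j)) ` set (restricted_growths n j))"
      by (cases k) (simp_all add: atLeast0LessThan lessThan_Suc)
    show ?case
    proof
      fix \<sigma> assume "\<sigma> \<in> set (restricted_growths (Suc n) k)"
      then have "(\<exists>\<tau>\<in>set (restricted_growths n k). \<exists>i\<in>{..<k}. \<sigma> = \<tau>(n := i)) \<or>
          (\<exists>j. k = Suc j \<and> (\<exists>\<tau>\<in>set (restricted_growths n j). \<sigma> = \<tau>(n := j)))"
        unfolding set_eq by (cases k) (simp_all only: nat.case, blast+)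
      then show "\<sigma> ` {..<Suc n} = {..<k}"
        by (elim disjE bexE exE conjE) (simp_all only: upd[unfolded lessThan_Suc] Suc.IH[rule_format] lessThan_Suc insert_absorb)
    qed
  qed simp
  then show "\<sigma> \<in> set (restricted_growths n k) \<Longrightarrow> \<sigma> ` {..<n} = {..<k}" by blast
qed

lemma restricted_growths_empty: "n < k \<Longrightarrow> restricted_growths n k = []"
  by (induction n arbitrary: k) (auto split: nat.splits)

lemma restricted_growths_Suc_0: "restricted_growths (Suc n) 0 = []"
  by (simp add: concat_eq_Nil_conv)

lemma sum_list_concat_map:
  "(\<Sum>x\<leftarrow>concat (map g xs). h x) = (\<Sum>x\<leftarrow>xs. \<Sum>y\<leftarrow>g x. h y)"
  by (induction xs) auto

lemma sum_list_restricted_growths_Suc: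
  fixes G :: "(nat \<Rightarrow> nat) \<Rightarrow> 'f::comm_monoid_add"
  shows "(\<Sum>\<sigma>\<leftarrow>restricted_growths (Suc n) k. G \<sigma>) =
    (\<Sum>\<sigma>\<leftarrow>restricted_growths n k. \<Sum>i<k. G (\<sigma>(n := i))) +
    (case k of 0 \<Rightarrow> 0 | Suc j \<Rightarrow> \<Sum>\<sigma>\<leftarrow>restricted_growths n j. G (\<sigma>(n := j)))"
proof -
  have "(\<Sum>i\<leftarrow>[0..<k]. G (\<sigma>(n := i))) = (\<Sum>i<k. G (\<sigma>(n := i)))" for \<sigma>
    by (simp add: interv_sum_list_conv_sum_set_nat atLeast0LessThan)
  then show ?thesis by (simp add: sum_list_concat_map o_def split: nat.splits)
qed

text \<open>Integrate out the last variable first and split \<omega> into the kernel of the next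
  falling factorial plus the point masses at \<open>x 0\<close>, ..., \<open>x (k - 1)\<close>. The
  kernel lets element \<open>n\<close> open a new block numbered \<open>k\<close>; the point mass at
  \<open>x i\<close> puts it into block \<open>i\<close>. This is the recursion of
  \<open>restricted_growths\<close>.\<close>

lemma tensor_integral_eq_falling:
  fixes f :: "(nat \<Rightarrow> 'a::{second_countable_topology, t2_space}) \<Rightarrow> 'f::{real_normed_field, euclidean_space}"
  assumes "admissible n f"
  shows "interp_integral 0 \<omega> n f =
    (\<Sum>k\<le>n. \<Sum>\<sigma>\<leftarrow>restricted_growths n k. interp_integral 1 \<omega> k (\<lambda>x. f (\<lambda>i\<in>{..<n}. x (\<sigma> i))))"
  using assms
proof (induction n arbitrary: f)
  case 0
  show ?case by (simp add: interp_integral_0 restrict_def)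
next
  case (Suc n)
  define F where "F u = radon_integral \<omega> (\<lambda>y. f (u(n := y)))" for u
  define G where "G k \<sigma> = interp_integral 1 \<omega> k (\<lambda>x. f (\<lambda>i\<in>{..<Suc n}. x (\<sigma> i)))" for k and \<sigma> :: "nat \<Rightarrow> nat"
  note f = Suc.prems
  have step: "interp_integral 1 \<omega> k (\<lambda>x. F (\<lambda>i\<in>{..<n}. x (\<sigma> i))) = G (Suc k) (\<sigma>(n := k)) + (\<Sum>i<k. G k (\<sigma>(n := i)))"
    if "\<sigma> \<in> set (restricted_growths n k)" for k \<sigma>
  proof -
    have im: "\<sigma> ` {..<n} = {..<k}" by (rule restricted_growths_image[OF that])
    then have lt: "i < n \<Longrightarrow> \<sigma> i < k" for i by auto
    define g where "g x = f (\<lambda>i\<in>{..<Suc n}. x ((\<sigma>(n := k)) i))" for x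
    have "(\<sigma>(n := k)) ` {..<Suc n} = {..<Suc k}" using im by (auto simp: lessThan_Suc)
    then have g: "admissible (Suc k) g" unfolding g_def by (rule admissible_pull[OF f])
    have h: "admissible k (\<lambda>x. f (\<lambda>j\<in>{..<Suc n}. x ((\<sigma>(n := i)) j)))" if "i < k" for i
    proof (rule admissible_pull[OF f])
      show "(\<sigma>(n := i)) ` {..<Suc n} = {..<k}" using im that by (auto simp: lessThan_Suc)
    qed
    have gx: "g (x(k := y)) = f ((\<lambda>i\<in>{..<n}. x (\<sigma> i))(n := y))" for x y
      unfolding g_def using lt by (intro arg_cong[where f = f]) (auto simp: fun_eq_iff less_Suc_eq)
    have hx: "f (\<lambda>j\<in>{..<Suc n}. x ((\<sigma>(n := i)) j)) = f ((\<lambda>i\<in>{..<n}. x (\<sigma> i))(n := x i))" for x i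
      by (intro arg_cong[where f = f]) (auto simp: fun_eq_iff less_Suc_eq)
    have "F (\<lambda>i\<in>{..<n}. x (\<sigma> i)) = radon_integral (interp_kernel 1 \<omega> k x) (\<lambda>y. g (x(k := y)))
        + (\<Sum>i<k. f (\<lambda>j\<in>{..<Suc n}. x ((\<sigma>(n := i)) j)))" if "x \<in> tuples k" for x
      using interp_kernel_integral[OF admissible_section[OF g that], of 1 \<omega> k x]
      unfolding F_def gx hx by simp
    then have "interp_integral 1 \<omega> k (\<lambda>x. F (\<lambda>i\<in>{..<n}. x (\<sigma> i))) = interp_integral 1 \<omega> k (\<lambda>x.
        radon_integral (interp_kernel 1 \<omega> k x) (\<lambda>y. g (x(k := y)))
        + (\<Sum>i<k. f (\<lambda>j\<in>{..<Suc n}. x ((\<sigma>(n := i)) j))))" by (rule interp_integral_cong)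
    also have "\<dots> = interp_integral 1 \<omega> (Suc k) g + (\<Sum>i<k. G k (\<sigma>(n := i)))"
      using h by (simp only: interp_integral_Suc G_def)
        (subst interp_integral_add, auto intro!: admissible_interp_kernel g admissible_sum interp_integral_sum)
    finally show ?thesis by (simp add: G_def g_def[abs_def])
  qed
  have "interp_integral 0 \<omega> (Suc n) f = interp_integral 0 \<omega> n F"
    by (simp add: interp_integral_Suc F_def[abs_def] interp_kernel_def)
  also have "\<dots> = (\<Sum>k\<le>n. \<Sum>\<sigma>\<leftarrow>restricted_growths n k. interp_integral 1 \<omega> k (\<lambda>x. F (\<lambda>i\<in>{..<n}. x (\<sigma> i))))"
    by (rule Suc.IH) (unfold F_def, rule admissible_integral[OF f])
  also have "\<dots> = (\<Sum>k\<le>n. \<Sum>\<sigma>\<leftarrow>restricted_growths n k. G (Suc k) (\<sigma>(n := k)) + (\<Sum>i<k. G k (\<sigma>(n := i))))"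
    by (intro sum.cong refl arg_cong[where f = sum_list] map_cong step)
  also have "\<dots> = (\<Sum>k\<le>n. \<Sum>\<sigma>\<leftarrow>restricted_growths n k. \<Sum>i<k. G k (\<sigma>(n := i))) +
      (\<Sum>k\<le>n. \<Sum>\<sigma>\<leftarrow>restricted_growths n k. G (Suc k) (\<sigma>(n := k)))"
    by (simp add: sum_list_addf sum.distrib add.commute)
  \<comment> \<open>The terms that open a block are reindexed by one. The two extra boundary terms
    vanish: there is no partition of \<open>n\<close> elements into \<open>n + 1\<close> blocks, and
    no block can be opened at level 0.\<close>
  also have "\<dots> = (\<Sum>k\<le>Suc n. \<Sum>\<sigma>\<leftarrow>restricted_growths (Suc n) k. G k \<sigma>)"
    unfolding sum_list_restricted_growths_Suc sum.distrib
    by (subst (2) sum.atMost_Suc_shift) (simp add: restricted_growths_empty)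
  finally show ?case unfolding G_def .
qed

section \<open>Falling factorials of sums of point masses\<close>

text \<open>Entry \<open>k\<close> is chosen after all earlier ones, which matches peeling off the
  innermost integration of \<open>iterated_integral\<close>. Values from argument \<open>k\<close>
  on keep the default 0 and carry no meaning.\<close>

primrec injections :: "nat \<Rightarrow> nat \<Rightarrow> (nat \<Rightarrow> nat) list" where
  "injections m 0 = [\<lambda>_. 0]"
| "injections m (Suc k) =
     concat (map (\<lambda>\<iota>. map (\<lambda>i. \<iota>(k := i)) (filter (\<lambda>i. i \<notin> \<iota> ` {..<k}) [0..<m])) (injections m k))"

lemma injections_inj:
  "\<iota> \<in> set (injections m k) \<Longrightarrow> inj_on \<iota> {..<k} \<and> \<iota> ` {..<k} \<subseteq> {..<m}"
proof (induction k arbitrary: \<iota>)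
  case (Suc k)
  then obtain \<kappa> i where \<iota>: "\<iota> = \<kappa>(k := i)" "\<kappa> \<in> set (injections m k)" "i < m" "i \<notin> \<kappa> ` {..<k}" by auto
  with Suc.IH[of \<kappa>] show ?case
    by (auto simp: inj_on_def lessThan_Suc)
qed auto

lemma length_injections: "length (injections m k) = (\<Prod>i<k. m - i)"
proof (induction k)
  case (Suc k)
  have "length (filter (\<lambda>i. i \<notin> \<iota> ` {..<k}) [0..<m]) = m - k" if "\<iota> \<in> set (injections m k)" for \<iota>
  proof -
    have "length (filter (\<lambda>i. i \<notin> \<iota> ` {..<k}) [0..<m]) = card ({..<m} - \<iota> ` {..<k})"
      by (subst distinct_card[symmetric]) (auto intro: arg_cong[where f = card])
    also have "\<dots> = m - k"
      using injections_inj[OF that] by (subst card_Diff_subset) (auto simp: card_image)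
    finally show ?thesis .
  qed
  then have "length (injections m (Suc k)) = (\<Sum>\<iota>\<leftarrow>injections m k. m - k)"
    by (simp add: length_concat o_def cong: map_cong)
  then show ?case using Suc by (simp add: sum_list_triv mult.commute)
qed auto

lemma falling_integral_dirac_sum:
  fixes g :: "(nat \<Rightarrow> 'a::t2_space) \<Rightarrow> 'f::{real_normed_field, euclidean_space}"
  assumes "admissible k g"
  shows "interp_integral 1 (\<Sum>i<m. dirac (y i)) k g = (\<Sum>\<iota>\<leftarrow>injections m k. g (\<lambda>i\<in>{..<k}. y (\<iota> i)))"
  using assms
proof (induction k arbitrary: g)
  case 0
  show ?case by (simp add: interp_integral_0 restrict_def)
next
  case (Suc k)
  let ?N = "\<Sum>i<m. dirac (y i)"
  have "interp_integral 1 ?N (Suc k) g = (\<Sum>\<iota>\<leftarrow>injections m k.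
      radon_integral (interp_kernel 1 ?N k (\<lambda>i\<in>{..<k}. y (\<iota> i))) (\<lambda>z. g ((\<lambda>i\<in>{..<k}. y (\<iota> i))(k := z))))"
    unfolding interp_integral_Suc by (rule Suc.IH) (rule admissible_interp_kernel[OF Suc.prems])
  also have "\<dots> = (\<Sum>\<iota>\<leftarrow>injections m k. \<Sum>i\<leftarrow>filter (\<lambda>i. i \<notin> \<iota> ` {..<k}) [0..<m]. g (\<lambda>j\<in>{..<Suc k}. y ((\<iota>(k := i)) j)))"
  proof (intro arg_cong[where f = sum_list] map_cong refl)
    fix \<iota> assume "\<iota> \<in> set (injections m k)"
    then have \<iota>: "inj_on \<iota> {..<k}" "\<iota> ` {..<k} \<subseteq> {..<m}" using injections_inj by auto
    define u where "u = (\<lambda>i\<in>{..<k}. y (\<iota> i))"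
    have u: "u \<in> tuples k" "\<And>i. i < k \<Longrightarrow> u i = y (\<iota> i)" by (auto simp: u_def)
    note t = admissible_section[OF Suc.prems u(1)]
    have "radon_integral (interp_kernel 1 ?N k u) (\<lambda>z. g (u(k := z))) =
        (\<Sum>i<m. g (u(k := y i))) - (\<Sum>i<k. g (u(k := y (\<iota> i))))"
      unfolding interp_kernel_integral[OF t] radon_integral_measure_sum[OF t] radon_integral_dirac[OF t]
      by (simp add: u(2))
    \<comment> \<open>Injectivity of \<iota> turns the subtracted sum into one over a set of
      indices, so that it cancels part of the sum over all \<open>i < m\<close>.\<close>
    also have "(\<Sum>i<k. g (u(k := y (\<iota> i)))) = (\<Sum>i\<in>\<iota> ` {..<k}. g (u(k := y i)))"
      by (simp add: sum.reindex[OF \<iota>(1)])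
    also have "(\<Sum>i<m. g (u(k := y i))) - (\<Sum>i\<in>\<iota> ` {..<k}. g (u(k := y i))) =
        (\<Sum>i\<in>{..<m} - \<iota> ` {..<k}. g (u(k := y i)))"
      by (rule sum_diff[symmetric]) (use \<iota> in auto)
    also have "\<dots> = (\<Sum>i\<leftarrow>filter (\<lambda>i. i \<notin> \<iota> ` {..<k}) [0..<m]. g (u(k := y i)))"
      by (subst sum_list_distinct_conv_sum_set) (auto intro: sum.cong)
    also have "(\<lambda>i. g (u(k := y i))) = (\<lambda>i. g (\<lambda>j\<in>{..<Suc k}. y ((\<iota>(k := i)) j)))"
      by (intro ext arg_cong[where f = g]) (auto simp: fun_eq_iff less_Suc_eq u_def)
    finally show "radon_integral (interp_kernel 1 ?N k (\<lambda>i\<in>{..<k}. y (\<iota> i))) (\<lambda>z. g ((\<lambda>i\<in>{..<k}. y (\<iota> i))(k := z))) =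
        (\<Sum>i\<leftarrow>filter (\<lambda>i. i \<notin> \<iota> ` {..<k}) [0..<m]. g (\<lambda>j\<in>{..<Suc k}. y ((\<iota>(k := i)) j)))"
      unfolding u_def .
  qed
  finally show ?case by (simp only: injections.simps sum_list_concat_map map_map comp_def)
qed

section \<open>Symmetric functions are determined by their falling factorial integrals\<close>

definition symmetric :: "nat \<Rightarrow> ((nat \<Rightarrow> 'a) \<Rightarrow> 'f) \<Rightarrow> bool" where
  "symmetric k f \<longleftrightarrow> (\<forall>\<pi> x. \<pi> permutes {..<k} \<longrightarrow> x \<in> tuples k \<longrightarrow> f (x \<circ> \<pi>) = f x)"

text \<open>For compactness in the product topology, the union of the coordinate projections of
  \<open>C\<close> confines all coordinates to one compact set; conversely the box over a compact
  set is compact by Tychonoff.\<close>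

lemma sym_functions_iff:
  fixes f :: "(nat \<Rightarrow> 'a::t2_space) \<Rightarrow> 'f::real_normed_vector"
  shows "f \<in> sym_functions k \<longleftrightarrow> admissible k f \<and> symmetric k f \<and> (\<forall>x. x \<notin> tuples k \<longrightarrow> f x = 0)"
proof
  assume f: "f \<in> sym_functions k"
  then obtain C where C: "compactin (product_topology (\<lambda>_. euclidean) {..<k}) C" "\<And>x. x \<notin> C \<Longrightarrow> f x = 0"
    by (auto simp: sym_functions_def)
  have sub: "C \<subseteq> tuples k" using compactin_subset_topspace[OF C(1)] by simp
  obtain c where c: "\<And>x. norm (f x) \<le> c" using f by (auto simp: sym_functions_def bounded_iff)
  define K where "K = (\<Union>i<k. (\<lambda>x. x i) ` C)"
  have "compact ((\<lambda>x. x i) ` C)" if "i < k" for i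
  proof -
    have "continuous_map (product_topology (\<lambda>_. euclidean :: 'a topology) {..<k}) euclidean (\<lambda>x. x i)"
      using that by (intro continuous_map_product_projection) auto
    from image_compactin[OF C(1) this] show ?thesis by simp
  qed
  then have "compact K" unfolding K_def by (intro compact_UN) auto
  then have "admissible k f"
    using f c C(2) by (intro admissibleI[of _ _ c K]) (force simp: sym_functions_def K_def)+
  then show "admissible k f \<and> symmetric k f \<and> (\<forall>x. x \<notin> tuples k \<longrightarrow> f x = 0)"
    using f C sub by (auto simp: sym_functions_def symmetric_def)
next
  assume f: "admissible k f \<and> symmetric k f \<and> (\<forall>x. x \<notin> tuples k \<longrightarrow> f x = 0)"
  then have ad: "admissible k f" by simp
  obtain c K where 1: "f \<in> borel_measurable (\<Pi>\<^sub>M i\<in>{..<k}. borel)"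
    "\<And>x. x \<in> tuples k \<Longrightarrow> norm (f x) \<le> c" "compact K"
    "\<And>x i. \<lbrakk>x \<in> tuples k; i < k; x i \<notin> K\<rbrakk> \<Longrightarrow> f x = 0" by (rule admissibleE[OF ad]) blast
  have "compactin (product_topology (\<lambda>_. euclidean) {..<k}) (\<Pi>\<^sub>E i\<in>{..<k}. K)"
    using 1(3) by (simp add: compactin_PiE)
  moreover have "f x = 0" if "x \<notin> (\<Pi>\<^sub>E i\<in>{..<k}. K)" for x
  proof (cases "x \<in> tuples k")
    case True
    then show ?thesis using 1(4)[OF True] that by (auto simp: PiE_iff)
  qed (use f in auto)
  moreover have "norm (f x) \<le> max c 0" for x using 1(2)[of x] f by (cases "x \<in> tuples k") auto
  then have "bounded (range f)" by (auto simp: bounded_iff)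
  ultimately show "f \<in> sym_functions k" using f 1(1) by (auto simp: sym_functions_def symmetric_def)
qed

lemma sym_functions_lincomb:
  fixes f g :: "(nat \<Rightarrow> 'a::t2_space) \<Rightarrow> 'f::{real_normed_field, euclidean_space}"
  assumes "f \<in> sym_functions k" "g \<in> sym_functions k"
  shows "(\<lambda>x. a * f x + b * g x) \<in> sym_functions k"
  using assms by (auto simp: sym_functions_iff symmetric_def intro!: admissible_add admissible_cmult)

text \<open>Evaluate at a sum of \<open>k\<close> point masses. Levels below \<open>k\<close> vanish
  by induction and levels above \<open>k\<close> because there are no injections, so
  \<open>k!\<close> times the value of \<open>g k\<close> at the chosen points remains.\<close>

lemma falling_integral_eq_0_imp:
  fixes g :: "nat \<Rightarrow> (nat \<Rightarrow> 'a::t2_space) \<Rightarrow> 'f::{real_normed_field, euclidean_space}"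
  assumes g: "\<And>k. k \<in> {1..n} \<Longrightarrow> g k \<in> sym_functions k"
    and 0: "\<And>\<omega>. (\<Sum>k=1..n. falling_integral \<omega> k (g k)) = 0"
    and k: "k \<in> {1..n}"
  shows "g k = (\<lambda>_. 0)"
  using k
proof (induction k rule: less_induct)
  case (less k)
  have "g k y = 0" if y: "y \<in> tuples k" for y
  proof -
    \<comment> \<open>\<open>(N)_j\<close> vanishes for \<open>j > k\<close>, and the points \<open>y i\<close> need not be distinct.\<close>
    let ?N = "\<Sum>i<k. dirac (y i)"
    have "falling_integral ?N j (g j) = 0" if "j \<in> {1..n} - {k}" for j
    proof (cases "j < k")
      case True
      then show ?thesis using less.IH[of j] that
        by (simp add: falling_integral_interp interp_integral_const_0)
    next
      case False
      then have "length (injections k j) = 0" using that by (auto simp: length_injections)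
      then have "injections k j = []" by simp
      then show ?thesis using falling_integral_dirac_sum[where k = j and g = "g j" and m = k and y = y] g[of j] that
        by (simp add: falling_integral_interp sym_functions_iff)
    qed
    then have "(\<Sum>j=1..n. falling_integral ?N j (g j)) = falling_integral ?N k (g k)"
      using less.prems by (subst sum.remove[of _ k]) auto
    then have "(\<Sum>\<iota>\<leftarrow>injections k k. g k (\<lambda>i\<in>{..<k}. y (\<iota> i))) = 0"
      using 0 g[OF less.prems] falling_integral_dirac_sum[where k = k and g = "g k" and m = k and y = y]
      by (simp add: falling_integral_interp sym_functions_iff)
    moreover have "g k (\<lambda>i\<in>{..<k}. y (\<iota> i)) = g k y" if "\<iota> \<in> set (injections k k)" for \<iota>
    proof -
      have "bij_betw \<iota> {..<k} {..<k}"
        using injections_inj[OF that] by (simp add: bij_betw_def endo_inj_surj)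
      \<comment> \<open>An entry of \<open>injections\<close> is 0 beyond \<open>k\<close>, so it
        has to be replaced there by the identity to become a permutation.\<close>
      then have p: "(\<lambda>i. if i \<in> {..<k} then \<iota> i else i) permutes {..<k}" (is "?\<pi> permutes _")
        by (intro bij_imp_permutes) (auto intro: bij_betw_cong[THEN iffD1, rotated])
      have "(\<lambda>i\<in>{..<k}. y (\<iota> i)) = (\<lambda>i\<in>{..<k}. y (?\<pi> i))" by auto
      also have "\<dots> = y \<circ> ?\<pi>" by (rule tuples_comp_permutes_eq[OF p y])
      finally show ?thesis using g[OF less.prems] p y by (simp add: sym_functions_iff symmetric_def)
    qed
    ultimately have "of_nat (\<Prod>i<k. k - i) * g k y = 0"
      by (simp add: sum_list_triv length_injections flip: of_nat_prod cong: map_cong)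
    then show ?thesis by auto
  qed
  then show ?case using g[OF less.prems] by (auto simp: sym_functions_iff fun_eq_iff)
qed

section \<open>Existence and uniqueness of the Stirling operators\<close>

text \<open>The sum over restricted growth functions alone is not a symmetric function of \<open>x\<close>: for \<open>n = 3\<close>, \<open>k = 2\<close>
  it is \<open>f(a, b, b) + 2 f(a, a, b)\<close>.\<close>

definition partition_sum ::
    "nat \<Rightarrow> nat \<Rightarrow> ((nat \<Rightarrow> 'a) \<Rightarrow> 'f::field_char_0) \<Rightarrow> (nat \<Rightarrow> 'a) \<Rightarrow> 'f" where
  "partition_sum n k f x = (if x \<in> tuples k
     then inverse (fact k) * (\<Sum>\<pi> | \<pi> permutes {..<k}. \<Sum>\<sigma>\<leftarrow>restricted_growths n k. f (\<lambda>i\<in>{..<n}. (x \<circ> \<pi>) (\<sigma> i)))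
     else 0)"

lemma admissible_growth_sum:
  fixes f :: "(nat \<Rightarrow> 'a::t2_space) \<Rightarrow> 'f::{real_normed_field, euclidean_space}"
  assumes "admissible n f"
  shows "admissible k (\<lambda>x. \<Sum>\<sigma>\<leftarrow>restricted_growths n k. f (\<lambda>i\<in>{..<n}. x (\<sigma> i)))"
  by (intro admissible_sum_list admissible_pull[OF assms] restricted_growths_image)

lemma partition_sum_sym_functions:
  fixes f :: "(nat \<Rightarrow> 'a::t2_space) \<Rightarrow> 'f::{real_normed_field, euclidean_space}"
  assumes f: "admissible n f"
  shows "partition_sum n k f \<in> sym_functions k"
proof -
  let ?g = "\<lambda>x. \<Sum>\<sigma>\<leftarrow>restricted_growths n k. f (\<lambda>i\<in>{..<n}. x (\<sigma> i))"
  have "admissible k (\<lambda>x. inverse (fact k) * (\<Sum>\<pi> | \<pi> permutes {..<k}. ?g (x \<circ> \<pi>)))"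
    by (intro admissible_cmult admissible_sum admissible_permute admissible_growth_sum f) auto
  then have "admissible k (partition_sum n k f)"
    by (rule admissible_cong[THEN iffD1, rotated]) (simp add: partition_sum_def)
  moreover have "partition_sum n k f (x \<circ> \<rho>) = partition_sum n k f x"
    if \<rho>: "\<rho> permutes {..<k}" and x: "x \<in> tuples k" for \<rho> x
  proof -
    have "(\<Sum>\<pi> | \<pi> permutes {..<k}. ?g (x \<circ> \<rho> \<circ> \<pi>)) = (\<Sum>\<pi> | \<pi> permutes {..<k}. ?g (x \<circ> \<pi>))"
      unfolding comp_assoc by (rule setum_permutations_compose_left[OF \<rho>, symmetric])
    then show ?thesis using comp_permutes_tuples[OF \<rho> x] x by (simp add: partition_sum_def)
  qed
  ultimately show ?thesis by (auto simp: sym_functions_iff symmetric_def partition_sum_def)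
qed

text \<open>The averaging over permutations is invisible to the integral: all \<open>k!\<close>
  permuted integrands have the same integral.\<close>

lemma interp_integral_partition_sum:
  fixes f :: "(nat \<Rightarrow> 'a::{second_countable_topology, t2_space}) \<Rightarrow> 'f::{real_normed_field, euclidean_space}"
  assumes f: "admissible n f"
  shows "interp_integral c \<omega> k (partition_sum n k f) =
    (\<Sum>\<sigma>\<leftarrow>restricted_growths n k. interp_integral c \<omega> k (\<lambda>x. f (\<lambda>i\<in>{..<n}. x (\<sigma> i))))"
proof -
  let ?g = "\<lambda>x. \<Sum>\<sigma>\<leftarrow>restricted_growths n k. f (\<lambda>i\<in>{..<n}. x (\<sigma> i))"
  have "interp_integral c \<omega> k (partition_sum n k f) =
      interp_integral c \<omega> k (\<lambda>x. inverse (fact k) * (\<Sum>\<pi> | \<pi> permutes {..<k}. ?g (x \<circ> \<pi>)))"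
    by (rule interp_integral_cong) (simp add: partition_sum_def)
  also have "\<dots> = inverse (fact k) * (\<Sum>\<pi> | \<pi> permutes {..<k}. interp_integral c \<omega> k (\<lambda>x. ?g (x \<circ> \<pi>)))"
    unfolding interp_integral_cmult
    by (subst interp_integral_sum) (rule admissible_permute[OF admissible_growth_sum[OF f]], simp, simp)
  also have "(\<Sum>\<pi> | \<pi> permutes {..<k}. interp_integral c \<omega> k (\<lambda>x. ?g (x \<circ> \<pi>))) =
      (\<Sum>\<pi> | \<pi> permutes {..<k}. interp_integral c \<omega> k ?g)"
    by (intro sum.cong refl interp_integral_permute admissible_growth_sum f) auto
  also have "\<dots> = fact k * interp_integral c \<omega> k ?g"
    by (simp add: card_permutations[of _ k])
  also have "interp_integral c \<omega> k ?g = (\<Sum>\<sigma>\<leftarrow>restricted_growths n k. interp_integral c \<omega> k (\<lambda>x. f (\<lambda>i\<in>{..<n}. x (\<sigma> i))))"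
    by (intro interp_integral_sum_list admissible_pull[OF f] restricted_growths_image)
  finally show ?thesis by simp
qed

lemma is_stirling_family_unique:
  fixes S T :: "nat \<Rightarrow> ((nat \<Rightarrow> 'a::t2_space) \<Rightarrow> 'f::{real_normed_field, euclidean_space}) \<Rightarrow> (nat \<Rightarrow> 'a) \<Rightarrow> 'f"
  assumes S: "is_stirling_family n S" and T: "is_stirling_family n T"
  shows "S = T"
proof -
  have mem: "S k f \<in> sym_functions k" "T k f \<in> sym_functions k" if "k \<in> {1..n}" "f \<in> sym_functions n" for k f
    using S T that unfolding is_stirling_family_def by blast+
  have eq: "S k f = T k f" if k: "k \<in> {1..n}" and f: "f \<in> sym_functions n" for k f
  proof -
    \<comment> \<open>The difference is written as a linear combination so that
      \<open>sym_functions_lincomb\<close> applies; it solves the defining identity with left side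
      0.\<close>
    have "(\<lambda>x. 1 * S k f x + (- 1) * T k f x) = (\<lambda>_. 0)"
    proof (rule falling_integral_eq_0_imp[OF _ _ k])
      show "(\<lambda>x. 1 * S j f x + (- 1) * T j f x) \<in> sym_functions j" if "j \<in> {1..n}" for j
        by (intro sym_functions_lincomb mem that f)
      fix \<omega> :: "('a, 'f) radon"
      have "falling_integral \<omega> j (\<lambda>x. 1 * S j f x + (- 1) * T j f x) =
          falling_integral \<omega> j (S j f) - falling_integral \<omega> j (T j f)" if "j \<in> {1..n}" for j
      proof -
        have "admissible j (S j f)" "admissible j (T j f)" using mem[OF that f] by (auto simp: sym_functions_iff)
        then have "falling_integral \<omega> j (\<lambda>x. 1 * S j f x + (- 1) * T j f x) =
            falling_integral \<omega> j (\<lambda>x. 1 * S j f x) + falling_integral \<omega> j (\<lambda>x. (- 1) * T j f x)"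
          unfolding falling_integral_interp by (intro interp_integral_add admissible_cmult)
        then show ?thesis unfolding falling_integral_interp interp_integral_cmult by simp
      qed
      then have "(\<Sum>j=1..n. falling_integral \<omega> j (\<lambda>x. 1 * S j f x + (- 1) * T j f x)) =
          (\<Sum>j=1..n. falling_integral \<omega> j (S j f)) - (\<Sum>j=1..n. falling_integral \<omega> j (T j f))"
        by (simp add: sum_subtractf)
      also have "\<dots> = tensor_integral \<omega> n f - tensor_integral \<omega> n f"
        using S T f unfolding is_stirling_family_def by simp
      finally show "(\<Sum>j=1..n. falling_integral \<omega> j (\<lambda>x. 1 * S j f x + (- 1) * T j f x)) = 0" by simp
    qed
    then show ?thesis by (simp add: fun_eq_iff)
  qed
  \<comment> \<open>Extensionality upgrades equality on the relevant \<open>k\<close> and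
    \<open>f\<close> to equality of the families, as needed for \<open>THE\<close>.\<close>
  have PiE: "S \<in> (\<Pi>\<^sub>E k\<in>{1..n}. sym_functions n \<rightarrow>\<^sub>E sym_functions k)"
    "T \<in> (\<Pi>\<^sub>E k\<in>{1..n}. sym_functions n \<rightarrow>\<^sub>E sym_functions k)"
    using S T unfolding is_stirling_family_def by blast+
  have "S k = T k" if "k \<in> {1..n}" for k
    by (rule PiE_ext[OF PiE_mem[OF PiE(1) that] PiE_mem[OF PiE(2) that] eq[OF that]])
  then show ?thesis by (rule PiE_ext[OF PiE])
qed

text \<open>Since \<open>stirling_op\<close> is a definite description, everything known about it
  passes through this lemma. The witness is the averaged sum over set partitions.\<close>

lemma is_stirling_family_stirling_op:
  assumes n: "n \<ge> 1"
  shows "is_stirling_family n (stirling_op n :: nat \<Rightarrow> ((nat \<Rightarrow> 'a::{second_countable_topology, t2_space}) \<Rightarrow> 'f::{real_normed_field, euclidean_space}) \<Rightarrow> _)"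
proof -
  define S :: "nat \<Rightarrow> ((nat \<Rightarrow> 'a) \<Rightarrow> 'f) \<Rightarrow> (nat \<Rightarrow> 'a) \<Rightarrow> 'f"
    where "S = (\<lambda>k\<in>{1..n}. \<lambda>f\<in>sym_functions n. partition_sum n k f)"
  have S: "S k f = partition_sum n k f" if "k \<in> {1..n}" "f \<in> sym_functions n" for k f
    using that by (simp add: S_def)
  have "is_stirling_family n S"
    unfolding is_stirling_family_def
  proof (intro conjI ballI allI)
    show "S \<in> (\<Pi>\<^sub>E k\<in>{1..n}. sym_functions n \<rightarrow>\<^sub>E sym_functions k)"
      unfolding S_def by (intro restrict_PiE_iff[THEN iffD2] ballI partition_sum_sym_functions) (simp add: sym_functions_iff)
    show "S k (\<lambda>x. a * f x + b * g x) = (\<lambda>x. a * S k f x + b * S k g x)"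
      if "k \<in> {1..n}" "f \<in> sym_functions n" "g \<in> sym_functions n" for k f g a b
      using that by (auto simp: S sym_functions_lincomb partition_sum_def fun_eq_iff
          sum_list_addf sum.distrib sum_list_const_mult sum_distrib_left algebra_simps)
    show "tensor_integral \<omega> n f = (\<Sum>k=1..n. falling_integral \<omega> k (S k f))"
      if f: "f \<in> sym_functions n" for f \<omega>
    proof -
      have ad: "admissible n f" using f by (simp add: sym_functions_iff)
      obtain m where m: "n = Suc m" using n by (cases n) auto
      have "tensor_integral \<omega> n f = (\<Sum>k\<le>n. \<Sum>\<sigma>\<leftarrow>restricted_growths n k.
          interp_integral 1 \<omega> k (\<lambda>x. f (\<lambda>i\<in>{..<n}. x (\<sigma> i))))"
        unfolding tensor_integral_interp by (rule tensor_integral_eq_falling[OF ad])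
      also have "\<dots> = (\<Sum>k=1..n. \<Sum>\<sigma>\<leftarrow>restricted_growths n k.
          interp_integral 1 \<omega> k (\<lambda>x. f (\<lambda>i\<in>{..<n}. x (\<sigma> i))))"
        \<comment> \<open>The term \<open>k = 0\<close> disappears because a nonempty set has no
          partition into zero blocks.\<close>
        unfolding m by (intro sum.mono_neutral_right) (auto simp: not_le restricted_growths_Suc_0 simp del: restricted_growths.simps)
      also have "\<dots> = (\<Sum>k=1..n. falling_integral \<omega> k (S k f))"
        by (intro sum.cong refl) (simp add: S f falling_integral_interp interp_integral_partition_sum[OF ad])
      finally show ?thesis .
    qed
  qed
  then have "\<exists>!S :: nat \<Rightarrow> ((nat \<Rightarrow> 'a) \<Rightarrow> 'f) \<Rightarrow> (nat \<Rightarrow> 'a) \<Rightarrow> 'f. is_stirling_family n S"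
    using is_stirling_family_unique by blast
  then show ?thesis unfolding stirling_op_def by (rule theI')
qed

section \<open>Polynomials and differential operators\<close>

lemma tensor_integral_Suc:
  "tensor_integral \<omega> (Suc k) f = tensor_integral \<omega> k (\<lambda>x. radon_integral \<omega> (\<lambda>y. f (x(k := y))))"
  by (simp add: tensor_integral_def)

lemma tensor_integral_0: "tensor_integral \<omega> 0 f = f (\<lambda>_. undefined)"
  by (simp add: tensor_integral_def)

lemmas tensor_integral_cong = interp_integral_cong[where c = 0, folded tensor_integral_interp]
lemmas tensor_integral_add = interp_integral_add[where c = 0, folded tensor_integral_interp]
lemmas tensor_integral_sum = interp_integral_sum[where c = 0, folded tensor_integral_interp]
lemmas tensor_integral_sum_list = interp_integral_sum_list[where c = 0, folded tensor_integral_interp]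
lemmas tensor_integral_permute = interp_integral_permute[where c = 0, folded tensor_integral_interp]

lemma symmetric_fix:
  fixes f :: "(nat \<Rightarrow> 'a) \<Rightarrow> 'f"
  assumes "symmetric (Suc k) f"
  shows "symmetric k (\<lambda>u. f (u(k := y)))"
  unfolding symmetric_def
proof (intro allI impI)
  fix \<pi> and x :: "nat \<Rightarrow> 'a" assume \<pi>: "\<pi> permutes {..<k}" and x: "x \<in> tuples k"
  have "\<pi> permutes {..<Suc k}" by (rule permutes_subset[OF \<pi>]) auto
  then show "f ((x \<circ> \<pi>)(k := y)) = f (x(k := y))"
    using assms fun_upd_tuples[OF x] unfolding fun_upd_comp_permutes[OF \<pi>] symmetric_def by blast
qed

lemma symmetric_integral:
  assumes "symmetric (Suc k) f"
  shows "symmetric k (\<lambda>u. radon_integral \<omega> (\<lambda>y. f (u(k := y))))"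
  using symmetric_fix[OF assms] by (simp add: symmetric_def)

lemma symmetric_swap_last:
  assumes "symmetric (Suc (Suc j)) f" "u \<in> tuples j"
  shows "f (u(j := x, Suc j := y)) = f (u(j := y, Suc j := x))"
proof -
  have "Transposition.transpose j (Suc j) permutes {..<Suc (Suc j)}" by (rule permutes_swap_id) auto
  then have "f (u(j := y, Suc j := x) \<circ> Transposition.transpose j (Suc j)) = f (u(j := y, Suc j := x))"
    using assms fun_upd_tuples[OF fun_upd_tuples[OF assms(2)]] unfolding symmetric_def by blast
  also have "u(j := y, Suc j := x) \<circ> Transposition.transpose j (Suc j) = u(j := x, Suc j := y)"
    by (auto simp: fun_eq_iff Transposition.transpose_def)
  finally show ?thesis .
qed

lemma admissible_degree_0: "admissible 0 f"
  by (rule admissible_cong[of 0 "\<lambda>_. f (\<lambda>_. undefined)", THEN iffD1])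
    (auto intro!: admissibleI[of _ _ "norm (f (\<lambda>_. undefined))" "{}"])

lemma symmetric_degree_0: "symmetric 0 f"
  by (simp add: symmetric_def)

section \<open>Derivatives of homogeneous polynomials\<close>

text \<open>Integrating out the last variable against the shifted measure gives
  \<open>A + z * B\<close>, affine in \<open>z\<close>. The product rule contributes
  \<open>B\<close> once, and differentiating the integral of \<open>A\<close> contributes it
  \<open>k\<close> more times by symmetry, giving the factor \<open>Suc k\<close>.\<close>

lemma tensor_integral_has_derivative:
  fixes f :: "(nat \<Rightarrow> 'a::t2_space) \<Rightarrow> 'f::{real_normed_field, euclidean_space}"
  assumes "admissible m f" "symmetric m f"
  shows "((\<lambda>z. tensor_integral (\<omega> + scale_radon z (dirac x)) m f) has_field_derivative
    of_nat m * tensor_integral \<omega> (m - 1) (\<lambda>u. f (u(m - 1 := x)))) (at 0)"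
  using assms
proof (induction m arbitrary: f)
  case 0
  then show ?case by (simp add: tensor_integral_0)
next
  case (Suc k)
  note f = Suc.prems
  define A where "A u = radon_integral \<omega> (\<lambda>y. f (u(k := y)))" for u
  define B where "B u = f (u(k := x))" for u
  let ?\<omega> = "\<lambda>z. \<omega> + scale_radon z (dirac x)"
  have A: "admissible k A" "symmetric k A"
    unfolding A_def[abs_def] by (intro admissible_integral symmetric_integral f)+
  have B: "admissible k B" "symmetric k B"
    unfolding B_def[abs_def] by (intro admissible_fix symmetric_fix f)+
  have "radon_integral (?\<omega> z) (\<lambda>y. f (u(k := y))) = A u + z * B u" if "u \<in> tuples k" for z u
    using admissible_section[OF f(1) that] unfolding A_def B_def
    by (simp only: radon_integral_measure_add radon_integral_measure_scale radon_integral_dirac)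
  then have "tensor_integral (?\<omega> z) (Suc k) f = tensor_integral (?\<omega> z) k (\<lambda>u. A u + z * B u)" for z
    unfolding tensor_integral_Suc by (rule tensor_integral_cong)
  then have eq: "tensor_integral (?\<omega> z) (Suc k) f = tensor_integral (?\<omega> z) k A + z * tensor_integral (?\<omega> z) k B" for z
    by (simp add: tensor_integral_add A B admissible_cmult tensor_integral_cmult)
  have deriv: "((\<lambda>z. tensor_integral (?\<omega> z) k A + z * tensor_integral (?\<omega> z) k B) has_field_derivative
      of_nat k * tensor_integral \<omega> (k - 1) (\<lambda>u. A (u(k - 1 := x))) + tensor_integral \<omega> k B) (at 0)"
  proof -
    have dA: "((\<lambda>z. tensor_integral (?\<omega> z) k A) has_field_derivative
        of_nat k * tensor_integral \<omega> (k - 1) (\<lambda>u. A (u(k - 1 := x)))) (at 0)" by (rule Suc.IH[OF A])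
    show ?thesis
      using DERIV_add[OF dA DERIV_mult'[OF DERIV_ident Suc.IH[OF B]]] by simp
  qed
  \<comment> \<open>For \<open>k = 0\<close> both sides vanish by the factor
    \<open>of_nat k\<close>. Otherwise symmetry allows fixing the last slot and integrating the one
    before it instead of the reverse.\<close>
  have AB: "of_nat k * tensor_integral \<omega> (k - 1) (\<lambda>u. A (u(k - 1 := x))) = of_nat k * tensor_integral \<omega> k B"
  proof (cases k)
    case (Suc j)
    have "tensor_integral \<omega> j (\<lambda>u. A (u(j := x))) = tensor_integral \<omega> (Suc j) B"
      unfolding tensor_integral_Suc
    proof (rule tensor_integral_cong)
      fix u :: "nat \<Rightarrow> 'a" assume "u \<in> tuples j"
      then show "A (u(j := x)) = radon_integral \<omega> (\<lambda>y. B (u(j := y)))"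
        unfolding A_def B_def Suc using symmetric_swap_last[of j f u x] f Suc by simp
    qed
    then show ?thesis by (simp add: Suc)
  qed simp
  have B': "tensor_integral \<omega> (Suc k - 1) (\<lambda>u. f (u(Suc k - 1 := x))) = tensor_integral \<omega> k B"
    unfolding B_def diff_Suc_1 ..
  show ?case
    using deriv unfolding eq B' AB by (simp add: distrib_right add.commute)
qed

text \<open>\<open>Lim\<close> is informative only if the limit exists, so partial derivatives are
  always computed from an established derivative.\<close>

lemma partial_at_eqI:
  assumes "((\<lambda>z. p (\<omega> + scale_radon z (dirac x))) has_field_derivative D) (at 0)"
  shows "partial_at x p \<omega> = D"
  using assms unfolding partial_at_def has_field_derivative_iff by (intro tendsto_Lim) auto

text \<open>Coefficients and degrees are arbitrary functions of the index so that the class is visibly closed under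
  \<open>partial_at\<close>, which does not preserve the relation between index and degree.\<close>

definition homogeneous_sum ::
    "'i set \<Rightarrow> ('i \<Rightarrow> 'f) \<Rightarrow> ('i \<Rightarrow> nat) \<Rightarrow> ('i \<Rightarrow> (nat \<Rightarrow> 'a) \<Rightarrow> 'f)
      \<Rightarrow> ('a::t2_space, 'f::{real_normed_field, euclidean_space}) radon \<Rightarrow> 'f" where
  "homogeneous_sum I a d f \<omega> = (\<Sum>m\<in>I. a m * tensor_integral \<omega> (d m) (f m))"

lemma partial_at_homogeneous_sum:
  fixes f :: "'i \<Rightarrow> (nat \<Rightarrow> 'a::t2_space) \<Rightarrow> 'f::{real_normed_field, euclidean_space}"
  assumes "\<And>m. m \<in> I \<Longrightarrow> admissible (d m) (f m)" "\<And>m. m \<in> I \<Longrightarrow> symmetric (d m) (f m)"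
  shows "partial_at x (homogeneous_sum I a d f) =
    homogeneous_sum I (\<lambda>m. a m * of_nat (d m)) (\<lambda>m. d m - 1) (\<lambda>m u. f m (u(d m - 1 := x)))"
proof
  fix \<omega>
  show "partial_at x (homogeneous_sum I a d f) \<omega> =
    homogeneous_sum I (\<lambda>m. a m * of_nat (d m)) (\<lambda>m. d m - 1) (\<lambda>m u. f m (u(d m - 1 := x))) \<omega>"
    unfolding homogeneous_sum_def mult.assoc
    by (intro partial_at_eqI DERIV_sum DERIV_cmult tensor_integral_has_derivative assms)
qed

section \<open>Iterated derivatives and the higher order operators\<close>

definition join_tuples :: "nat \<Rightarrow> nat \<Rightarrow> (nat \<Rightarrow> 'a) \<Rightarrow> (nat \<Rightarrow> 'a) \<Rightarrow> nat \<Rightarrow> 'a" where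
  "join_tuples k l x u = (\<lambda>i. if i < k then x i else if i < k + l then u (i - k) else undefined)"

lemma join_tuples_in: "join_tuples k l x u \<in> tuples (k + l)"
  by (auto simp: join_tuples_def PiE_iff extensional_def)

lemma join_tuples_0: "x \<in> tuples k \<Longrightarrow> join_tuples k 0 x u = x"
  by (auto simp: join_tuples_def PiE_iff extensional_def fun_eq_iff)

lemma fun_upd_join_tuples: "(join_tuples k l x u)(k + l := y) = join_tuples k (Suc l) x (u(l := y))"
  by (auto simp: join_tuples_def fun_eq_iff)

text \<open>Derivatives fill the last slots of \<open>f\<close>, whereas
  \<open>tensor_integral_join\<close> places the outer integration variables first. Exchanging the
  two blocks is a permutation, to which a symmetric \<open>f\<close> is blind.\<close>

lemma join_tuples_commute:
  assumes "symmetric (k + l) f"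
  shows "f (join_tuples l k u x) = f (join_tuples k l x u)"
proof -
  define \<pi> where "\<pi> i = (if i < l then i + k else if i < k + l then i - l else i)" for i
  have "bij_betw \<pi> {..<k + l} {..<k + l}"
    by (rule bij_betw_byWitness[where f' = "\<lambda>i. if i < k then i + l else i - k"]) (auto simp: \<pi>_def)
  then have \<pi>: "\<pi> permutes {..<k + l}" by (rule bij_imp_permutes) (auto simp: \<pi>_def)
  have "join_tuples l k u x = join_tuples k l x u \<circ> \<pi>"
    by (auto simp: fun_eq_iff join_tuples_def \<pi>_def)
  then show ?thesis using assms \<pi> join_tuples_in[of k l x u] by (simp add: symmetric_def)
qed

lemma tensor_integral_join:
  fixes G :: "(nat \<Rightarrow> 'a::t2_space) \<Rightarrow> 'f::{real_normed_field, euclidean_space}"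
  shows "tensor_integral \<omega> (k + l) G = tensor_integral \<omega> k (\<lambda>x. tensor_integral \<omega> l (\<lambda>u. G (join_tuples k l x u)))"
proof (induction l arbitrary: G)
  case 0
  show ?case by (simp add: tensor_integral_0) (rule tensor_integral_cong, simp add: join_tuples_0)
next
  case (Suc l)
  then show ?case by (simp add: tensor_integral_Suc fun_upd_join_tuples)
qed

lemma admissible_join:
  fixes G :: "(nat \<Rightarrow> 'a::t2_space) \<Rightarrow> 'f::{real_normed_field, euclidean_space}"
  assumes "admissible (k + l) G"
  shows "admissible k (\<lambda>x. tensor_integral \<omega> l (\<lambda>u. G (join_tuples k l x u)))"
  using assms
proof (induction l arbitrary: G)
  case 0
  then have "admissible k G" by simp
  then show ?case by (rule admissible_cong[THEN iffD1, rotated]) (simp add: tensor_integral_0 join_tuples_0)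
next
  case (Suc l)
  then show ?case using Suc.IH[OF admissible_integral[where f = G and \<nu> = \<omega>]] Suc.prems by (simp add: tensor_integral_Suc fun_upd_join_tuples)
qed

text \<open>The \<open>foldr\<close> applies the derivative at the last point first, and that point
  enters the last slot, so the points end up in their original order. Each derivative lowers the
  degrees and changes coefficients and integrands, hence the induction generalizes over all
  three.\<close>

lemma iterated_partial_at_homogeneous_sum:
  fixes f :: "'i \<Rightarrow> (nat \<Rightarrow> 'a::t2_space) \<Rightarrow> 'f::{real_normed_field, euclidean_space}"
  assumes "\<And>m. m \<in> I \<Longrightarrow> admissible (d m) (f m)" "\<And>m. m \<in> I \<Longrightarrow> symmetric (d m) (f m)"
  shows "foldr (\<lambda>i. partial_at (x i)) [0..<k] (homogeneous_sum I a d f) =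
    homogeneous_sum I (\<lambda>m. a m * of_nat (\<Prod>i<k. d m - i)) (\<lambda>m. d m - k) (\<lambda>m u. f m (join_tuples (d m - k) k u x))"
  using assms
proof (induction k arbitrary: a d f)
  case 0
  have "tensor_integral \<omega> (d m) (\<lambda>u. f m (join_tuples (d m) 0 u x)) = tensor_integral \<omega> (d m) (f m)" for m \<omega>
    by (intro tensor_integral_cong) (simp add: join_tuples_0)
  then show ?case by (simp add: homogeneous_sum_def fun_eq_iff)
next
  case (Suc k)
  let ?f = "\<lambda>m u. f m (u(d m - 1 := x k))"
  have ad: "admissible (d m - 1) (?f m)" "symmetric (d m - 1) (?f m)" if "m \<in> I" for m
    using Suc.prems[OF that] admissible_fix[of "d m - 1" "f m" "x k"] symmetric_fix[of "d m - 1" "f m" "x k"]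
    by (cases "d m"; simp add: admissible_degree_0 symmetric_degree_0)+
  have "foldr (\<lambda>i. partial_at (x i)) [0..<Suc k] (homogeneous_sum I a d f) =
      foldr (\<lambda>i. partial_at (x i)) [0..<k] (homogeneous_sum I (\<lambda>m. a m * of_nat (d m)) (\<lambda>m. d m - 1) ?f)"
    using Suc.prems by (simp add: partial_at_homogeneous_sum)
  also have "\<dots> = homogeneous_sum I (\<lambda>m. a m * of_nat (d m) * of_nat (\<Prod>i<k. d m - 1 - i)) (\<lambda>m. d m - 1 - k)
      (\<lambda>m u. ?f m (join_tuples (d m - 1 - k) k u x))"
    by (rule Suc.IH[OF ad])
  also have "\<dots> = homogeneous_sum I (\<lambda>m. a m * of_nat (\<Prod>i<Suc k. d m - i)) (\<lambda>m. d m - Suc k)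
      (\<lambda>m u. f m (join_tuples (d m - Suc k) (Suc k) u x))"
    unfolding homogeneous_sum_def
  proof (intro ext sum.cong refl)
    fix \<omega> m assume "m \<in> I"
    have c: "a m * of_nat (d m) * of_nat (\<Prod>i<k. d m - 1 - i) = a m * of_nat (\<Prod>i<Suc k. d m - i)"
      by (subst prod.lessThan_Suc_shift) simp
    show "a m * of_nat (d m) * of_nat (\<Prod>i<k. d m - 1 - i) *
        tensor_integral \<omega> (d m - 1 - k) (\<lambda>u. ?f m (join_tuples (d m - 1 - k) k u x)) =
      a m * of_nat (\<Prod>i<Suc k. d m - i) *
        tensor_integral \<omega> (d m - Suc k) (\<lambda>u. f m (join_tuples (d m - Suc k) (Suc k) u x))"
    proof (cases "Suc k \<le> d m")
      case True
      then obtain l where l: "d m = Suc (l + k)" by (auto simp: le_iff_add add.commute)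
      have "(join_tuples l k u x)(l + k := x k) = join_tuples l (Suc k) u x" for u
        by (auto simp: join_tuples_def fun_eq_iff)
      then show ?thesis unfolding c by (simp add: l)
    next
      \<comment> \<open>Here the truncated subtractions make the slots meaningless, but the
        coefficient contains the factor 0 at \<open>i = d m\<close>.\<close>
      case False
      then have "(\<Prod>i<Suc k. d m - i) = 0" by (intro prod_zero) auto
      then show ?thesis unfolding c by simp
    qed
  qed
  finally show ?case .
qed

text \<open>The factor \<open>f\<close> supplies the compact support in all \<open>d\<close> slots,
  so \<open>g\<close> may read only some of them.\<close>

lemma admissible_times_restrict:
  fixes f :: "(nat \<Rightarrow> 'a::t2_space) \<Rightarrow> 'f::{real_normed_field, euclidean_space}"
  assumes g: "g \<in> borel_measurable (\<Pi>\<^sub>M i\<in>{..<k}. borel)" "\<And>x. x \<in> tuples k \<Longrightarrow> norm (g x) \<le> b"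
    and f: "admissible d f" and \<sigma>: "\<sigma> ` {..<k} \<subseteq> {..<d}"
  shows "admissible d (\<lambda>v. g (\<lambda>i\<in>{..<k}. v (\<sigma> i)) * f v)"
proof (rule admissible_times[OF _ _ f])
  have "(\<lambda>x. \<lambda>i\<in>{..<k}. x (\<sigma> i)) \<in> measurable (\<Pi>\<^sub>M i\<in>{..<d}. borel) (\<Pi>\<^sub>M i\<in>{..<k}. (borel :: 'a measure))"
    using \<sigma> by (intro measurable_restrict measurable_component_singleton) auto
  from measurable_comp[OF this g(1)]
  show "(\<lambda>v. g (\<lambda>i\<in>{..<k}. v (\<sigma> i))) \<in> borel_measurable (\<Pi>\<^sub>M i\<in>{..<d}. borel)" by (simp add: o_def)
  show "norm (g (\<lambda>i\<in>{..<k}. v (\<sigma> i))) \<le> b" for v by (rule g(2)) auto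
qed

text \<open>The \<open>k\<close>-fold derivative leaves an integral over the remaining variables;
  integrating the differentiation points against the \<open>k\<close>-th power of \<omega> restores
  the full product measure, with \<open>g\<close> reading the first \<open>k\<close> slots. Degrees
  are preserved, and terms of degree below \<open>k\<close> have coefficient 0.\<close>

lemma higher_order_op_homogeneous_sum:
  fixes f :: "'i \<Rightarrow> (nat \<Rightarrow> 'a::t2_space) \<Rightarrow> 'f::{real_normed_field, euclidean_space}"
  assumes g: "g \<in> borel_measurable (\<Pi>\<^sub>M i\<in>{..<k}. borel)" "\<And>x. x \<in> tuples k \<Longrightarrow> norm (g x) \<le> b"
    and f: "\<And>m. m \<in> I \<Longrightarrow> admissible (d m) (f m)" "\<And>m. m \<in> I \<Longrightarrow> symmetric (d m) (f m)"
  shows "higher_order_op k g (homogeneous_sum I a d f) =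
    homogeneous_sum I (\<lambda>m. a m * of_nat (\<Prod>i<k. d m - i)) d (\<lambda>m v. g (\<lambda>i\<in>{..<k}. v i) * f m v)"
proof
  fix \<omega>
  define c where "c m = a m * of_nat (\<Prod>i<k. d m - i)" for m
  define h where "h m x = g x * (c m * tensor_integral \<omega> (d m - k) (\<lambda>u. f m (join_tuples (d m - k) k u x)))" for m x
  have hm: "admissible k (h m) \<and> tensor_integral \<omega> k (h m) =
      c m * tensor_integral \<omega> (d m) (\<lambda>v. g (\<lambda>i\<in>{..<k}. v i) * f m v)" if m: "m \<in> I" for m
  proof (cases "k \<le> d m")
    case True
    then obtain l where l: "d m = k + l" by (auto simp: le_iff_add)
    define G where "G v = g (\<lambda>i\<in>{..<k}. v i) * f m v" for v
    have G: "admissible (k + l) G"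
      unfolding G_def[abs_def] by (rule admissible_times_restrict[OF g, where \<sigma> = "\<lambda>i. i"]) (use f(1)[OF m] l in auto)
    have hG: "h m x = c m * tensor_integral \<omega> l (\<lambda>u. G (join_tuples k l x u))" if x: "x \<in> tuples k" for x
    proof -
      have r: "(\<lambda>i\<in>{..<k}. join_tuples k l x u i) = x" for u
        using x by (auto simp: join_tuples_def PiE_iff extensional_def fun_eq_iff)
      have "h m x = c m * tensor_integral \<omega> l (\<lambda>u. g x * f m (join_tuples l k u x))"
        by (simp add: h_def l tensor_integral_cmult mult_ac)
      also have "(\<lambda>u. g x * f m (join_tuples l k u x)) = (\<lambda>u. G (join_tuples k l x u))"
        using f(2)[OF m] by (simp add: G_def r l join_tuples_commute)
      finally show ?thesis .
    qed
    have "admissible k (h m)"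
      using admissible_cmult[OF admissible_join[OF G, of \<omega>], of "c m"]
      by (rule admissible_cong[THEN iffD1, rotated]) (rule hG[symmetric])
    moreover have "tensor_integral \<omega> k (h m) =
        tensor_integral \<omega> k (\<lambda>x. c m * tensor_integral \<omega> l (\<lambda>u. G (join_tuples k l x u)))"
      by (rule tensor_integral_cong) (rule hG)
    then have "tensor_integral \<omega> k (h m) = c m * tensor_integral \<omega> (k + l) G"
      by (simp add: tensor_integral_cmult tensor_integral_join)
    ultimately show ?thesis by (simp add: l G_def[abs_def])
  next
    case False
    then have "(\<Prod>i<k. d m - i) = 0" by (intro prod_zero) auto
    then have "c m = 0" unfolding c_def by (simp only: of_nat_0 mult_zero_right)
    moreover from this have "h m = (\<lambda>_. 0)" by (simp add: h_def[abs_def])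
    ultimately show ?thesis using tensor_integral_cmult[of \<omega> k 0 "\<lambda>_. 0"] by (simp add: admissible_0)
  qed
  have "foldr (\<lambda>i. partial_at (x i)) [0..<k] (homogeneous_sum I a d f) \<omega> =
      (\<Sum>m\<in>I. c m * tensor_integral \<omega> (d m - k) (\<lambda>u. f m (join_tuples (d m - k) k u x)))" for x
    using iterated_partial_at_homogeneous_sum[of I d f x k a] f by (simp add: homogeneous_sum_def c_def)
  then have "higher_order_op k g (homogeneous_sum I a d f) \<omega> = tensor_integral \<omega> k (\<lambda>x. \<Sum>m\<in>I. h m x)"
    by (simp add: higher_order_op_def h_def sum_distrib_left)
  also have "\<dots> = (\<Sum>m\<in>I. c m * tensor_integral \<omega> (d m) (\<lambda>v. g (\<lambda>i\<in>{..<k}. v i) * f m v))"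
    using hm by (simp add: tensor_integral_sum)
  finally show "higher_order_op k g (homogeneous_sum I a d f) \<omega> =
      homogeneous_sum I (\<lambda>m. a m * of_nat (\<Prod>i<k. d m - i)) d (\<lambda>m v. g (\<lambda>i\<in>{..<k}. v i) * f m v) \<omega>"
    by (simp add: homogeneous_sum_def c_def)
qed

section \<open>Relabelling of slots and the first order operators\<close>

text \<open>The complements of \<open>A\<close> and of its image in \<open>B\<close> have equal
  cardinality, and any bijection between them completes \<iota>.\<close>

lemma inj_on_extends_permutes:
  fixes \<iota> :: "'a \<Rightarrow> 'a"
  assumes "finite B" "A \<subseteq> B" "inj_on \<iota> A" "\<iota> ` A \<subseteq> B"
  obtains \<pi> where "\<pi> permutes B" "\<And>i. i \<in> A \<Longrightarrow> \<pi> i = \<iota> i"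
proof -
  have fin: "finite A" using assms finite_subset by blast
  have "card (B - A) = card (B - \<iota> ` A)"
    using assms fin by (simp add: card_Diff_subset card_image)
  then obtain h where h: "bij_betw h (B - A) (B - \<iota> ` A)"
    using assms(1) by (meson finite_Diff finite_same_card_bij)
  define \<pi> where "\<pi> i = (if i \<in> A then \<iota> i else if i \<in> B then h i else i)" for i
  have "bij_betw \<pi> A (\<iota> ` A)" using assms(3) by (auto simp: \<pi>_def bij_betw_def inj_on_def)
  moreover have "bij_betw \<pi> (B - A) (B - \<iota> ` A)"
    using h by (rule bij_betw_cong[THEN iffD1, rotated]) (simp add: \<pi>_def)
  ultimately have "bij_betw \<pi> (A \<union> (B - A)) (\<iota> ` A \<union> (B - \<iota> ` A))" by (rule bij_betw_combine) auto
  moreover have "A \<union> (B - A) = B" "\<iota> ` A \<union> (B - \<iota> ` A) = B" using assms by auto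
  ultimately have "bij_betw \<pi> B B" by simp
  then have "\<pi> permutes B" using assms(2) by (intro bij_imp_permutes) (auto simp: \<pi>_def)
  then show thesis by (rule that) (simp add: \<pi>_def)
qed

text \<open>Extend \<iota> to a permutation of all slots. Neither the product measure nor the
  symmetric \<open>f\<close> notices it, so only the slots read by \<open>g\<close> are
  moved.\<close>

lemma tensor_integral_relabel:
  fixes f :: "(nat \<Rightarrow> 'a::{second_countable_topology, t2_space}) \<Rightarrow> 'f::{real_normed_field, euclidean_space}"
  assumes g: "g \<in> borel_measurable (\<Pi>\<^sub>M i\<in>{..<k}. borel)" "\<And>x. x \<in> tuples k \<Longrightarrow> norm (g x) \<le> b"
    and f: "admissible d f" "symmetric d f" and \<iota>: "inj_on \<iota> {..<k}" "\<iota> ` {..<k} \<subseteq> {..<d}"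
  shows "tensor_integral \<omega> d (\<lambda>v. g (\<lambda>i\<in>{..<k}. v (\<iota> i)) * f v) =
    tensor_integral \<omega> d (\<lambda>v. g (\<lambda>i\<in>{..<k}. v i) * f v)"
proof -
  have "k \<le> d" using card_mono[OF _ \<iota>(2)] by (simp add: card_image[OF \<iota>(1)])
  then obtain \<pi> where \<pi>: "\<pi> permutes {..<d}" "\<And>i. i < k \<Longrightarrow> \<pi> i = \<iota> i"
    using inj_on_extends_permutes[of "{..<d}" "{..<k}" \<iota>] \<iota> by auto
  have "tensor_integral \<omega> d (\<lambda>v. g (\<lambda>i\<in>{..<k}. v (\<iota> i)) * f v) =
      tensor_integral \<omega> d (\<lambda>v. g (\<lambda>i\<in>{..<k}. (v \<circ> \<pi>) i) * f (v \<circ> \<pi>))"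
  proof (rule tensor_integral_cong)
    fix v :: "nat \<Rightarrow> 'a" assume "v \<in> tuples d"
    then have "f (v \<circ> \<pi>) = f v" using f(2) \<pi>(1) by (simp add: symmetric_def)
    moreover have "(\<lambda>i\<in>{..<k}. v (\<iota> i)) = (\<lambda>i\<in>{..<k}. (v \<circ> \<pi>) i)" using \<pi>(2) by auto
    ultimately show "g (\<lambda>i\<in>{..<k}. v (\<iota> i)) * f v = g (\<lambda>i\<in>{..<k}. (v \<circ> \<pi>) i) * f (v \<circ> \<pi>)" by simp
  qed
  also have "\<dots> = tensor_integral \<omega> d (\<lambda>v. g (\<lambda>i\<in>{..<k}. v i) * f v)"
    by (rule tensor_integral_permute[OF \<pi>(1)])
      (rule admissible_times_restrict[OF g f(1)], use \<open>k \<le> d\<close> in auto)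
  finally show ?thesis .
qed

lemma first_order_op_eq_higher_order_op:
  "first_order_op \<xi> p = higher_order_op 1 (\<lambda>x. \<xi> (x 0)) p"
  by (simp add: fun_eq_iff first_order_op_def higher_order_op_def tensor_integral_Suc tensor_integral_0)

text \<open>The case of one derivative produces \<open>d m\<close> times \<xi> at slot 0; by
  relabelling, every slot gives the same integral, so these copies may be replaced by the power sum.
  The replacement restores symmetry of the integrand, which lets the next operator be
  applied.\<close>

lemma first_order_op_homogeneous_sum:
  fixes f :: "'i \<Rightarrow> (nat \<Rightarrow> 'a::{second_countable_topology, t2_space}) \<Rightarrow> 'f::{real_normed_field, euclidean_space}"
  assumes \<xi>: "\<xi> \<in> test_functions"
    and f: "\<And>m. m \<in> I \<Longrightarrow> admissible (d m) (f m)" "\<And>m. m \<in> I \<Longrightarrow> symmetric (d m) (f m)"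
  shows "first_order_op \<xi> (homogeneous_sum I a d f) =
    homogeneous_sum I a d (\<lambda>m v. (\<Sum>i<d m. \<xi> (v i)) * f m v)"
proof -
  obtain c where \<xi>1: "\<xi> \<in> borel_measurable borel" "\<And>x. norm (\<xi> x) \<le> c"
    using \<xi> by (rule test_functionsE) blast
  define g where "g x = \<xi> (x 0)" for x :: "nat \<Rightarrow> 'a"
  have g: "g \<in> borel_measurable (\<Pi>\<^sub>M i\<in>{..<1}. borel)" "\<And>x. x \<in> tuples 1 \<Longrightarrow> norm (g x) \<le> c"
    using \<xi>1(2) measurable_compose[OF measurable_component_singleton[of "0::nat" "{..<1}" "\<lambda>_. borel"] \<xi>1(1)] by (simp_all add: g_def[abs_def])
  have "of_nat (d m) * tensor_integral \<omega> (d m) (\<lambda>v. g (\<lambda>i\<in>{..<1}. v i) * f m v) =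
      tensor_integral \<omega> (d m) (\<lambda>v. (\<Sum>i<d m. \<xi> (v i)) * f m v)" if m: "m \<in> I" for m \<omega>
  proof -
    have "tensor_integral \<omega> (d m) (\<lambda>v. \<Sum>i<d m. g (\<lambda>j\<in>{..<1}. v i) * f m v) =
        (\<Sum>i<d m. tensor_integral \<omega> (d m) (\<lambda>v. g (\<lambda>j\<in>{..<1}. v i) * f m v))"
      by (intro tensor_integral_sum admissible_times_restrict[OF g f(1)[OF m]]) auto
    also have "\<dots> = (\<Sum>i<d m. tensor_integral \<omega> (d m) (\<lambda>v. g (\<lambda>i\<in>{..<1}. v i) * f m v))"
      by (intro sum.cong refl tensor_integral_relabel[OF g f(1)[OF m] f(2)[OF m]]) (auto simp: inj_on_def)
    finally show ?thesis by (simp add: sum_distrib_right g_def)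
  qed
  moreover have "first_order_op \<xi> (homogeneous_sum I a d f) =
      homogeneous_sum I (\<lambda>m. a m * of_nat (\<Prod>i<1. d m - i)) d (\<lambda>m v. g (\<lambda>i\<in>{..<1}. v i) * f m v)"
    unfolding first_order_op_eq_higher_order_op g_def[symmetric] by (rule higher_order_op_homogeneous_sum[OF g f])
  ultimately show ?thesis
    by (auto simp: homogeneous_sum_def fun_eq_iff mult.assoc intro!: sum.cong)
qed

lemma admissible_power_sum_times:
  fixes f :: "(nat \<Rightarrow> 'a::t2_space) \<Rightarrow> 'f::{real_normed_field, euclidean_space}"
  assumes \<xi>: "\<xi> \<in> test_functions" and f: "admissible d f"
  shows "admissible d (\<lambda>v. (\<Sum>i<d. \<xi> (v i)) * f v)"
proof -
  obtain c where \<xi>1: "\<xi> \<in> borel_measurable borel" "\<And>x. norm (\<xi> x) \<le> c"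
    using \<xi> by (rule test_functionsE) blast
  have "admissible d (\<lambda>v. \<Sum>i<d. \<xi> (v i) * f v)"
    using \<xi>1 by (intro admissible_sum admissible_times[OF _ _ f, of _ c])
      (auto intro: measurable_compose[OF measurable_component_singleton])
  then show ?thesis by (simp add: sum_distrib_right)
qed

lemma symmetric_power_sum_times:
  fixes f :: "(nat \<Rightarrow> 'a) \<Rightarrow> 'f::comm_ring"
  assumes "symmetric d f"
  shows "symmetric d (\<lambda>v. (\<Sum>i<d. \<xi> (v i)) * f v)"
  unfolding symmetric_def
proof (intro allI impI)
  fix \<pi> and x :: "nat \<Rightarrow> 'a" assume \<pi>: "\<pi> permutes {..<d}" and "x \<in> tuples d"
  then have "f (x \<circ> \<pi>) = f x" using assms by (simp add: symmetric_def)
  then show "(\<Sum>i<d. \<xi> ((x \<circ> \<pi>) i)) * f (x \<circ> \<pi>) = (\<Sum>i<d. \<xi> (x i)) * f x"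
    using sum.permute[OF \<pi>, of "\<lambda>i. \<xi> (x i)"] by (simp add: comp_def)
qed

text \<open>Admissibility and symmetry of the new integrands are proved in the same induction,
  because each further operator presupposes them.\<close>

lemma foldr_first_order_op:
  fixes f :: "'i \<Rightarrow> (nat \<Rightarrow> 'a::{second_countable_topology, t2_space}) \<Rightarrow> 'f::{real_normed_field, euclidean_space}"
  assumes \<xi>: "\<And>j. j \<in> set js \<Longrightarrow> \<xi> j \<in> test_functions"
    and f: "\<And>m. m \<in> I \<Longrightarrow> admissible (d m) (f m)" "\<And>m. m \<in> I \<Longrightarrow> symmetric (d m) (f m)"
  defines "F \<equiv> \<lambda>js m v. (\<Prod>j\<leftarrow>js. \<Sum>i<d m. \<xi> j (v i)) * f m v"
  shows "foldr (\<lambda>j. first_order_op (\<xi> j)) js (homogeneous_sum I a d f) = homogeneous_sum I a d (F js)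
    \<and> (\<forall>m\<in>I. admissible (d m) (F js m) \<and> symmetric (d m) (F js m))"
  using \<xi>
proof (induction js)
  case Nil
  show ?case using f by (simp add: F_def)
next
  case (Cons j js)
  have IH: "foldr (\<lambda>j. first_order_op (\<xi> j)) js (homogeneous_sum I a d f) = homogeneous_sum I a d (F js)"
    "\<And>m. m \<in> I \<Longrightarrow> admissible (d m) (F js m)" "\<And>m. m \<in> I \<Longrightarrow> symmetric (d m) (F js m)"
    using Cons by auto
  have F: "F (j # js) = (\<lambda>m v. (\<Sum>i<d m. \<xi> j (v i)) * F js m v)"
    by (simp add: F_def mult.assoc)
  have \<xi>j: "\<xi> j \<in> test_functions" using Cons.prems by simp
  show ?case
    unfolding F
  proof (intro conjI ballI)
    show "foldr (\<lambda>j. first_order_op (\<xi> j)) (j # js) (homogeneous_sum I a d f) =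
        homogeneous_sum I a d (\<lambda>m v. (\<Sum>i<d m. \<xi> j (v i)) * F js m v)"
      using first_order_op_homogeneous_sum[OF \<xi>j, of I d "F js" a] IH by simp
  qed (rule admissible_power_sum_times[OF \<xi>j IH(2)] symmetric_power_sum_times[OF IH(3)], assumption)+
qed

section \<open>Symmetrized tensor products and products of power sums\<close>

lemma admissible_product:
  fixes h :: "nat \<Rightarrow> 'a::t2_space \<Rightarrow> 'f::{real_normed_field, euclidean_space}"
  assumes "\<And>i. i < n \<Longrightarrow> h i \<in> test_functions"
  shows "admissible n (\<lambda>x. \<Prod>i<n. h i (x i))"
proof -
  have "\<exists>c K. h i \<in> borel_measurable borel \<and> (\<forall>x. norm (h i x) \<le> c) \<and> compact K \<and> (\<forall>x. x \<notin> K \<longrightarrow> h i x = 0)"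
    if "i < n" for i using assms[OF that] by (rule test_functionsE) blast
  then obtain c K where h: "\<And>i. i < n \<Longrightarrow> h i \<in> borel_measurable borel" "\<And>i x. i < n \<Longrightarrow> norm (h i x) \<le> c i"
    "\<And>i. i < n \<Longrightarrow> compact (K i)" "\<And>i x. i < n \<Longrightarrow> x \<notin> K i \<Longrightarrow> h i x = 0"
    by metis
  show ?thesis
  proof (rule admissibleI)
    show "(\<lambda>x. \<Prod>i<n. h i (x i)) \<in> borel_measurable (\<Pi>\<^sub>M i\<in>{..<n}. borel)"
      using h(1) by (intro borel_measurable_prod) (auto intro: measurable_compose[OF measurable_component_singleton])
    show "norm (\<Prod>i<n. h i (x i)) \<le> (\<Prod>i<n. c i)" for x
      unfolding prod_norm[symmetric] using h(2) by (intro prod_mono) auto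
    show "compact (\<Union>i<n. K i)" using h(3) by (intro compact_UN) auto
    show "(\<Prod>i<n. h i (x i)) = 0" if "i < n" "x i \<notin> (\<Union>i<n. K i)" for x i
      using that h(4) by (intro prod_zero) auto
  qed
qed

lemma tensor_integral_product:
  "tensor_integral \<omega> n (\<lambda>x. \<Prod>i<n. h i (x i)) = (\<Prod>i<n. radon_integral \<omega> (h i))"
proof (induction n)
  case 0
  show ?case by (simp add: tensor_integral_0)
next
  case (Suc n)
  have "tensor_integral \<omega> (Suc n) (\<lambda>x. \<Prod>i<Suc n. h i (x i)) =
      tensor_integral \<omega> n (\<lambda>x. (\<Prod>i<n. h i (x i)) * radon_integral \<omega> (h n))"
    by (simp add: tensor_integral_Suc radon_integral_cmult)
  also have "\<dots> = radon_integral \<omega> (h n) * (\<Prod>i<n. radon_integral \<omega> (h i))"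
    using Suc by (simp add: tensor_integral_cmult flip: mult.commute[of "radon_integral \<omega> (h n)"])
  finally show ?case by (simp add: mult.commute)
qed

lemma sym_tensor_sym_functions:
  fixes \<xi> :: "nat \<Rightarrow> 'a::t2_space \<Rightarrow> 'f::{real_normed_field, euclidean_space}"
  assumes \<xi>: "\<And>i. i < n \<Longrightarrow> \<xi> i \<in> test_functions"
  shows "sym_tensor n \<xi> \<in> sym_functions n"
proof -
  have "admissible n (\<lambda>x. inverse (fact n) * (\<Sum>\<pi> | \<pi> permutes {..<n}. \<Prod>i<n. \<xi> (\<pi> i) (x i)))"
    using \<xi> permutes_in_image by (intro admissible_cmult admissible_sum admissible_product) fastforce
  then have "admissible n (sym_tensor n \<xi>)"
    by (rule admissible_cong[THEN iffD1, rotated]) (simp add: sym_tensor_def field_simps)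
  moreover have "sym_tensor n \<xi> (x \<circ> \<rho>) = sym_tensor n \<xi> x" if \<rho>: "\<rho> permutes {..<n}" and x: "x \<in> tuples n" for \<rho> x
  proof -
    have "(\<Prod>i<n. \<xi> ((\<pi> \<circ> \<rho>) i) ((x \<circ> \<rho>) i)) = (\<Prod>i<n. \<xi> (\<pi> i) (x i))" for \<pi>
      using prod.permute[OF \<rho>, of "\<lambda>i. \<xi> (\<pi> i) (x i)"] by (simp add: comp_def)
    then have "(\<Sum>\<pi> | \<pi> permutes {..<n}. \<Prod>i<n. \<xi> (\<pi> i) ((x \<circ> \<rho>) i)) = (\<Sum>\<pi> | \<pi> permutes {..<n}. \<Prod>i<n. \<xi> (\<pi> i) (x i))"
      by (subst sum_permutations_compose_right[OF \<rho>]) simp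
    then show ?thesis using comp_permutes_tuples[OF \<rho> x] x by (simp add: sym_tensor_def)
  qed
  ultimately show ?thesis by (auto simp: sym_functions_iff symmetric_def sym_tensor_def)
qed

text \<open>Each permuted product integrates to the same product of numbers, so the
  \<open>n!\<close> equal terms cancel the normalization.\<close>

lemma tensor_integral_sym_tensor:
  fixes \<xi> :: "nat \<Rightarrow> 'a::t2_space \<Rightarrow> 'f::{real_normed_field, euclidean_space}"
  assumes \<xi>: "\<And>i. i < n \<Longrightarrow> \<xi> i \<in> test_functions"
  shows "tensor_integral \<omega> n (sym_tensor n \<xi>) = (\<Prod>i<n. radon_integral \<omega> (\<xi> i))"
proof -
  have "tensor_integral \<omega> n (sym_tensor n \<xi>) =
      tensor_integral \<omega> n (\<lambda>x. inverse (fact n) * (\<Sum>\<pi> | \<pi> permutes {..<n}. \<Prod>i<n. \<xi> (\<pi> i) (x i)))"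
    by (rule tensor_integral_cong) (simp add: sym_tensor_def field_simps)
  also have "\<dots> = inverse (fact n) * (\<Sum>\<pi> | \<pi> permutes {..<n}. tensor_integral \<omega> n (\<lambda>x. \<Prod>i<n. \<xi> (\<pi> i) (x i)))"
    unfolding tensor_integral_cmult
    using \<xi> permutes_in_image by (subst tensor_integral_sum) (fastforce intro!: admissible_product)+
  also have "(\<Sum>\<pi> | \<pi> permutes {..<n}. tensor_integral \<omega> n (\<lambda>x. \<Prod>i<n. \<xi> (\<pi> i) (x i))) =
      (\<Sum>\<pi> | \<pi> permutes {..<n}. \<Prod>i<n. radon_integral \<omega> (\<xi> i))"
  proof (intro sum.cong refl)
    fix \<pi> assume "\<pi> \<in> {\<pi>. \<pi> permutes {..<n}}"
    then have \<pi>: "\<pi> permutes {..<n}" by simp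
    show "tensor_integral \<omega> n (\<lambda>x. \<Prod>i<n. \<xi> (\<pi> i) (x i)) = (\<Prod>i<n. radon_integral \<omega> (\<xi> i))"
      unfolding tensor_integral_product[of \<omega> n "\<lambda>i. \<xi> (\<pi> i)"] using prod.permute[OF \<pi>, of "\<lambda>i. radon_integral \<omega> (\<xi> i)"]
      by (simp add: comp_def)
  qed
  finally show ?thesis by (simp add: card_permutations[of _ n])
qed

text \<open>Both sides evaluate the integral of the symmetrized tensor against the
  \<open>n\<close>-th power of the counting measure of \<open>v\<close>: directly, and through the
  defining identity of the Stirling operators. The equation is pointwise in \<open>v\<close>, so it
  can be multiplied by another function and integrated.\<close>

lemma prod_power_sums_eq_stirling:
  fixes \<xi> :: "nat \<Rightarrow> 'a::{second_countable_topology, t2_space} \<Rightarrow> 'f::{real_normed_field, euclidean_space}"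
  assumes n: "n \<ge> 1" and \<xi>: "\<And>i. i < n \<Longrightarrow> \<xi> i \<in> test_functions"
  shows "(\<Prod>j<n. \<Sum>i<m. \<xi> j (v i)) =
    (\<Sum>k=1..n. \<Sum>\<iota>\<leftarrow>injections m k. stirling_op n k (sym_tensor n \<xi>) (\<lambda>i\<in>{..<k}. v (\<iota> i)))"
proof -
  let ?N = "\<Sum>i<m. dirac (v i) :: ('a, 'f) radon"
  note S = is_stirling_family_stirling_op[OF n, where 'a = 'a and 'f = 'f]
  have s: "sym_tensor n \<xi> \<in> sym_functions n" by (rule sym_tensor_sym_functions) (rule \<xi>)
  have "(\<Prod>j<n. \<Sum>i<m. \<xi> j (v i)) = tensor_integral ?N n (sym_tensor n \<xi>)"
    using \<xi> by (simp add: tensor_integral_sym_tensor radon_integral_measure_sum radon_integral_dirac)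
  also have "\<dots> = (\<Sum>k=1..n. falling_integral ?N k (stirling_op n k (sym_tensor n \<xi>)))"
    using S s unfolding is_stirling_family_def by blast
  also have "\<dots> = (\<Sum>k=1..n. \<Sum>\<iota>\<leftarrow>injections m k. stirling_op n k (sym_tensor n \<xi>) (\<lambda>i\<in>{..<k}. v (\<iota> i)))"
  proof (intro sum.cong refl)
    fix k assume "k \<in> {1..n}"
    then have "stirling_op n k (sym_tensor n \<xi>) \<in> sym_functions k"
      using S s unfolding is_stirling_family_def by blast
    then show "falling_integral ?N k (stirling_op n k (sym_tensor n \<xi>)) =
        (\<Sum>\<iota>\<leftarrow>injections m k. stirling_op n k (sym_tensor n \<xi>) (\<lambda>i\<in>{..<k}. v (\<iota> i)))"
      unfolding falling_integral_interp by (intro falling_integral_dirac_sum) (simp add: sym_functions_iff)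
  qed
  finally show ?thesis .
qed

section \<open>Comparison of both sides degree by degree\<close>

theorem theorem7p1:
  fixes \<xi> :: "nat \<Rightarrow> 'a::polish_space \<Rightarrow> 'f::{real_normed_field, euclidean_space}"
    and n :: nat
  assumes "locally_compact_space (euclidean :: 'a topology)"
    and "n \<ge> 1"
    and "\<And>i. i < n \<Longrightarrow> \<xi> i \<in> test_functions"
  shows "\<forall>p\<in>polynomials.
    foldr (\<lambda>i. first_order_op (\<xi> i)) [0..<n] p =
    (\<lambda>\<omega>. \<Sum>k=1..n. higher_order_op k (stirling_op n k (sym_tensor n \<xi>)) p \<omega>)"
proof
  fix p :: "('a, 'f) radon \<Rightarrow> 'f" assume "p \<in> polynomials"
  then obtain N f where f': "\<And>m. m \<le> N \<Longrightarrow> f m \<in> sym_functions m"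
    and p': "p = (\<lambda>\<omega>. \<Sum>m\<le>N. tensor_integral \<omega> m (f m))"
    unfolding polynomials_def by blast
  have f: "admissible m (f m)" "symmetric m (f m)" if "m \<in> {..N}" for m
    using f'[of m] that by (auto simp: sym_functions_iff)
  define I where "I = {..N}"
  have p: "p = homogeneous_sum I (\<lambda>_. 1) (\<lambda>m. m) f" by (simp add: p' homogeneous_sum_def fun_eq_iff I_def)
  define S where "S k = stirling_op n k (sym_tensor n \<xi>)" for k
  have "sym_tensor n \<xi> \<in> sym_functions n" by (rule sym_tensor_sym_functions) (rule assms(3))
  then have S: "S k \<in> sym_functions k" if "k \<in> {1..n}" for k
    using is_stirling_family_stirling_op[OF assms(2), where 'a = 'a and 'f = 'f] that
    unfolding is_stirling_family_def S_def by blast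
  have Sb: "\<exists>b. S k \<in> borel_measurable (\<Pi>\<^sub>M i\<in>{..<k}. borel) \<and> (\<forall>x\<in>tuples k. norm (S k x) \<le> b)"
    if "k \<in> {1..n}" for k
    using S[OF that] by (auto simp: sym_functions_iff admissible_def)
  \<comment> \<open>The pointwise power sum identity is multiplied by \<open>f m\<close> and
    integrated; relabelling then reduces every injection to the one reading the first
    \<open>k\<close> slots.\<close>
  have term_eq: "tensor_integral \<omega> m (\<lambda>v. (\<Prod>j<n. \<Sum>i<m. \<xi> j (v i)) * f m v) =
      (\<Sum>k=1..n. of_nat (\<Prod>i<k. m - i) * tensor_integral \<omega> m (\<lambda>v. S k (\<lambda>i\<in>{..<k}. v i) * f m v))"
    if m: "m \<in> I" for m and \<omega> :: "('a, 'f) radon"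
  proof -
    note fm = f[OF m[unfolded I_def]]
    have ad: "admissible m (\<lambda>v. S k (\<lambda>i\<in>{..<k}. v (\<iota> i)) * f m v)"
      and rel: "tensor_integral \<omega> m (\<lambda>v. S k (\<lambda>i\<in>{..<k}. v (\<iota> i)) * f m v) =
        tensor_integral \<omega> m (\<lambda>v. S k (\<lambda>i\<in>{..<k}. v i) * f m v)"
      if k: "k \<in> {1..n}" and \<iota>: "\<iota> \<in> set (injections m k)" for k \<iota>
    proof -
      obtain b where b: "S k \<in> borel_measurable (\<Pi>\<^sub>M i\<in>{..<k}. borel)" "\<And>x. x \<in> tuples k \<Longrightarrow> norm (S k x) \<le> b"
        using Sb[OF k] by blast
      show "admissible m (\<lambda>v. S k (\<lambda>i\<in>{..<k}. v (\<iota> i)) * f m v)"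
        using injections_inj[OF \<iota>] by (intro admissible_times_restrict[OF b fm(1)]) auto
      show "tensor_integral \<omega> m (\<lambda>v. S k (\<lambda>i\<in>{..<k}. v (\<iota> i)) * f m v) =
          tensor_integral \<omega> m (\<lambda>v. S k (\<lambda>i\<in>{..<k}. v i) * f m v)"
        using injections_inj[OF \<iota>] by (intro tensor_integral_relabel[OF b fm]) auto
    qed
    have "tensor_integral \<omega> m (\<lambda>v. (\<Prod>j<n. \<Sum>i<m. \<xi> j (v i)) * f m v) =
        tensor_integral \<omega> m (\<lambda>v. \<Sum>k=1..n. \<Sum>\<iota>\<leftarrow>injections m k. S k (\<lambda>i\<in>{..<k}. v (\<iota> i)) * f m v)"
      by (simp add: prod_power_sums_eq_stirling[OF assms(2,3)] S_def sum_distrib_right sum_list_mult_const)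
    also have "\<dots> = (\<Sum>k=1..n. tensor_integral \<omega> m (\<lambda>v. \<Sum>\<iota>\<leftarrow>injections m k. S k (\<lambda>i\<in>{..<k}. v (\<iota> i)) * f m v))"
      by (intro tensor_integral_sum admissible_sum_list ad)
    also have "\<dots> = (\<Sum>k=1..n. \<Sum>\<iota>\<leftarrow>injections m k. tensor_integral \<omega> m (\<lambda>v. S k (\<lambda>i\<in>{..<k}. v i) * f m v))"
    proof (intro sum.cong refl)
      fix k assume k: "k \<in> {1..n}"
      have "tensor_integral \<omega> m (\<lambda>v. \<Sum>\<iota>\<leftarrow>injections m k. S k (\<lambda>i\<in>{..<k}. v (\<iota> i)) * f m v) =
          (\<Sum>\<iota>\<leftarrow>injections m k. tensor_integral \<omega> m (\<lambda>v. S k (\<lambda>i\<in>{..<k}. v (\<iota> i)) * f m v))"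
        by (intro tensor_integral_sum_list ad k)
      also have "\<dots> = (\<Sum>\<iota>\<leftarrow>injections m k. tensor_integral \<omega> m (\<lambda>v. S k (\<lambda>i\<in>{..<k}. v i) * f m v))"
        by (intro arg_cong[where f = sum_list] map_cong refl rel k)
      finally show "tensor_integral \<omega> m (\<lambda>v. \<Sum>\<iota>\<leftarrow>injections m k. S k (\<lambda>i\<in>{..<k}. v (\<iota> i)) * f m v) = \<dots>" .
    qed
    \<comment> \<open>The summands no longer depend on the injection, and the number of injections
      is the coefficient that the \<open>k\<close> derivatives produce in
      \<open>hop\<close>.\<close>
    finally show ?thesis by (simp add: sum_list_triv length_injections)
  qed
  have hop: "higher_order_op k (S k) p = homogeneous_sum I (\<lambda>m. of_nat (\<Prod>i<k. m - i)) (\<lambda>m. m) (\<lambda>m v. S k (\<lambda>i\<in>{..<k}. v i) * f m v)"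
    if k: "k \<in> {1..n}" for k
  proof -
    obtain b where b: "S k \<in> borel_measurable (\<Pi>\<^sub>M i\<in>{..<k}. borel)" "\<And>x. x \<in> tuples k \<Longrightarrow> norm (S k x) \<le> b"
      using Sb[OF k] by blast
    show ?thesis
      using higher_order_op_homogeneous_sum[of "S k" k b I "\<lambda>m. m" f "\<lambda>_. 1", OF b] f
      unfolding p by (simp add: I_def)
  qed
  have "foldr (\<lambda>i. first_order_op (\<xi> i)) [0..<n] p =
      homogeneous_sum I (\<lambda>_. 1) (\<lambda>m. m) (\<lambda>m v. (\<Prod>j<n. \<Sum>i<m. \<xi> j (v i)) * f m v)"
    using foldr_first_order_op[of "[0..<n]" \<xi> I "\<lambda>m. m" f "\<lambda>_. 1"] assms(3) f
    unfolding p by (simp add: I_def atLeast0LessThan flip: prod.distinct_set_conv_list)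
  also have "\<dots> = (\<lambda>\<omega>. \<Sum>k=1..n. higher_order_op k (S k) p \<omega>)"
  proof
    fix \<omega>
    have "homogeneous_sum I (\<lambda>_. 1) (\<lambda>m. m) (\<lambda>m v. (\<Prod>j<n. \<Sum>i<m. \<xi> j (v i)) * f m v) \<omega> =
        (\<Sum>m\<in>I. \<Sum>k=1..n. of_nat (\<Prod>i<k. m - i) * tensor_integral \<omega> m (\<lambda>v. S k (\<lambda>i\<in>{..<k}. v i) * f m v))"
      unfolding homogeneous_sum_def by (intro sum.cong refl) (simp only: term_eq mult_1_left)
    also have "\<dots> = (\<Sum>k=1..n. higher_order_op k (S k) p \<omega>)"
      by (subst sum.swap) (intro sum.cong refl, simp only: hop homogeneous_sum_def)
    finally show "homogeneous_sum I (\<lambda>_. 1) (\<lambda>m. m) (\<lambda>m v. (\<Prod>j<n. \<Sum>i<m. \<xi> j (v i)) * f m v) \<omega> =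
        (\<Sum>k=1..n. higher_order_op k (S k) p \<omega>)" .
  qed
  finally show "foldr (\<lambda>i. first_order_op (\<xi> i)) [0..<n] p =
      (\<lambda>\<omega>. \<Sum>k=1..n. higher_order_op k (stirling_op n k (sym_tensor n \<xi>)) p \<omega>)"
    unfolding S_def .
qed

end
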